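(* Let $(G,d)$ be a group with a bi-invariant metric such that $d\le 1$ and $(G,d)$ is a continuous structure (i.e. $(G,d)$ is complete). Then the following statements hold. 1. $(G,d)$ is (isometrically isomorphic to) a closed subgroup of a metric ultraproduct of discrete bi-invariant metric groups. Moreover, if $G$ is weakly sofic in the standard sense (as an abstract group), then the groups occurring in the corresponding ultraproduct are weakly sofic too. 2. If $(G,d)$ is hyperlinear (as a metric group), then $(G,d)$ is (isometrically isomorphic to) a closed subgroup of a metric ultraproduct of discrete bi-invariant metric groups which are hyperlinear (as metric groups).
   Context: A bi-invariant metric group is a group with a bi-invariant metric, here bounded by $1$; it is discrete if the induced topology is discrete. Bi-invariant metrics $d$ correspond to invariant length functions $l$ via $d(g,h)=l(gh^{-1})$. The metric ultraproduct of groups $(G_i,d_i)$, $i\in I$, with uniformly bounded bi-invariant metrics, with respect to an ultrafilter $\Phi$ on $I$, is $(\prod_I G_i)/N$, where $N=\{(x_i):\lim_{i\to\Phi}d_i(x_i,1)=0\}$, with the metric $d(xN,yN)=\lim_{i\to\Phi}d_i(x_i,y_i)$. A group $G$ is weakly sofic (in the standard sense) if, as an abstract group, it embeds into a metric ultraproduct of finite groups with invariant length functions bounded by $1$. A hyperlinear metric group is a metric group $(G,d)$ with complete bi-invariant metric $d\le1$ which embeds by an isometric homomorphism into a metric ultraproduct of finite-dimensional unitary groups $U(n)$ equipped with the metrics $\frac12 d_{HS}$, where $d_{HS}(u,v)=\sqrt{\frac1n\mathrm{tr}((u-v)^*(u-v))}$ is the normalized Hilbert–Schmidt metric. *)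

theory Defs
  imports
    "HOL-Analysis.Abstract_Metric_Spaces"
    "HOL-Algebra.Product_Groups"
    "HOL-Algebra.Weak_Morphisms"
    "Jordan_Normal_Form.Schur_Decomposition"
begin

section \<open>Groups with bi-invariant metrics\<close>

text \<open>
  \<^locale>\<open>Metric_space\<close> wants its distance function to be nonnegative and symmetric also outside the
  underlying set.  The concrete distance functions below are therefore cut off to \<open>0\<close> there.
\<close>

definition on_carrier :: "('a, 'm) monoid_scheme \<Rightarrow> ('a \<Rightarrow> 'a \<Rightarrow> real) \<Rightarrow> 'a \<Rightarrow> 'a \<Rightarrow> real" where
  "on_carrier G d x y = (if x \<in> carrier G \<and> y \<in> carrier G then d x y else 0)"

locale bi_invariant_metric_group = group G + Metric_space "carrier G" d
  for G :: "('a, 'm) monoid_scheme" (structure) and d +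
  assumes left_invariant:
      "\<lbrakk>x \<in> carrier G; y \<in> carrier G; z \<in> carrier G\<rbrakk> \<Longrightarrow> d (z \<otimes> x) (z \<otimes> y) = d x y"
    and right_invariant:
      "\<lbrakk>x \<in> carrier G; y \<in> carrier G; z \<in> carrier G\<rbrakk> \<Longrightarrow> d (x \<otimes> z) (y \<otimes> z) = d x y"
    and dist_le_1: "\<lbrakk>x \<in> carrier G; y \<in> carrier G\<rbrakk> \<Longrightarrow> d x y \<le> 1"

definition complete_metric_group :: "('a, 'm) monoid_scheme \<Rightarrow> ('a \<Rightarrow> 'a \<Rightarrow> real) \<Rightarrow> bool" where
  "complete_metric_group G d \<longleftrightarrow>
     bi_invariant_metric_group G d \<and> Metric_space.mcomplete (carrier G) d"

definition discrete_metric_group :: "('a, 'm) monoid_scheme \<Rightarrow> ('a \<Rightarrow> 'a \<Rightarrow> real) \<Rightarrow> bool" where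
  "discrete_metric_group G d \<longleftrightarrow>
     bi_invariant_metric_group G d \<and>
     Metric_space.mtopology (carrier G) d = discrete_topology (carrier G)"

definition isometric_on ::
    "('a, 'm) monoid_scheme \<Rightarrow> ('a \<Rightarrow> 'a \<Rightarrow> real) \<Rightarrow> ('b \<Rightarrow> 'b \<Rightarrow> real) \<Rightarrow> ('a \<Rightarrow> 'b) \<Rightarrow> bool" where
  "isometric_on G d e f \<longleftrightarrow> (\<forall>x\<in>carrier G. \<forall>y\<in>carrier G. e (f x) (f y) = d x y)"

definition iso_to_closed_subgroup ::
    "('a, 'm) monoid_scheme \<Rightarrow> ('a \<Rightarrow> 'a \<Rightarrow> real) \<Rightarrow>
     ('b, 'n) monoid_scheme \<Rightarrow> ('b \<Rightarrow> 'b \<Rightarrow> real) \<Rightarrow> bool" where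
  "iso_to_closed_subgroup G d U e \<longleftrightarrow>
     (\<exists>K. subgroup K U \<and> closedin (Metric_space.mtopology (carrier U) e) K \<and>
        (\<exists>f \<in> iso G (U\<lparr>carrier := K\<rparr>). isometric_on G d e f))"

section \<open>Metric ultraproducts\<close>

definition ultrafilter_on :: "'i set \<Rightarrow> 'i filter \<Rightarrow> bool" where
  "ultrafilter_on I \<Phi> \<longleftrightarrow>
     \<Phi> \<noteq> bot \<and> eventually (\<lambda>i. i \<in> I) \<Phi> \<and>
     (\<forall>P. eventually P \<Phi> \<or> eventually (\<lambda>i. \<not> P i) \<Phi>)"

definition null_sequences ::
    "'i set \<Rightarrow> 'i filter \<Rightarrow> ('i \<Rightarrow> ('a, 'm) monoid_scheme) \<Rightarrow> ('i \<Rightarrow> 'a \<Rightarrow> 'a \<Rightarrow> real) \<Rightarrow> ('i \<Rightarrow> 'a) set" where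
  "null_sequences I \<Phi> H d =
     {x \<in> carrier (product_group I H). ((\<lambda>i. d i (x i) \<one>\<^bsub>H i\<^esub>) \<longlongrightarrow> 0) \<Phi>}"

definition ultraproduct ::
    "'i set \<Rightarrow> 'i filter \<Rightarrow> ('i \<Rightarrow> ('a, 'm) monoid_scheme) \<Rightarrow> ('i \<Rightarrow> 'a \<Rightarrow> 'a \<Rightarrow> real) \<Rightarrow> ('i \<Rightarrow> 'a) set monoid" where
  "ultraproduct I \<Phi> H d = product_group I H Mod null_sequences I \<Phi> H d"

text \<open>
  The distance of two cosets is the limit shared by all pairs of representatives; lemma
  \<open>ultra_dist_tendsto\<close> below shows that it exists.
\<close>

definition ultra_dist ::
    "'i set \<Rightarrow> 'i filter \<Rightarrow> ('i \<Rightarrow> ('a, 'm) monoid_scheme) \<Rightarrow> ('i \<Rightarrow> 'a \<Rightarrow> 'a \<Rightarrow> real) \<Rightarrow>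
     ('i \<Rightarrow> 'a) set \<Rightarrow> ('i \<Rightarrow> 'a) set \<Rightarrow> real" where
  "ultra_dist I \<Phi> H d =
     on_carrier (ultraproduct I \<Phi> H d)
       (\<lambda>A B. THE r. \<forall>x\<in>A. \<forall>y\<in>B. ((\<lambda>i. d i (x i) (y i)) \<longlongrightarrow> r) \<Phi>)"

text \<open>
  HOL cannot quantify existentially over types, so an ultraproduct that is claimed to exist for a
  group on the type \<open>'a\<close> is indexed by elements of the type below.  The lemmas
  \<open>weakly_sofic_if_embeds\<close> and \<open>hyperlinear_if_embeds\<close> at the end of this theory show that index
  sets of arbitrary types (and finite groups on arbitrary types) lead to the same notions.
\<close>

type_synonym 'a index = "'a set \<times> nat"

section \<open>Weakly sofic groups\<close>

definition invariant_length :: "('a, 'm) monoid_scheme \<Rightarrow> ('a \<Rightarrow> real) \<Rightarrow> bool" where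
  "invariant_length G l \<longleftrightarrow>
     (\<forall>x\<in>carrier G. 0 \<le> l x \<and> (l x = 0 \<longleftrightarrow> x = \<one>\<^bsub>G\<^esub>) \<and> l (inv\<^bsub>G\<^esub> x) = l x) \<and>
     (\<forall>x\<in>carrier G. \<forall>y\<in>carrier G. l (x \<otimes>\<^bsub>G\<^esub> y) \<le> l x + l y) \<and>
     (\<forall>x\<in>carrier G. \<forall>y\<in>carrier G. l (y \<otimes>\<^bsub>G\<^esub> x \<otimes>\<^bsub>G\<^esub> inv\<^bsub>G\<^esub> y) = l x)"

definition length_dist :: "('a, 'm) monoid_scheme \<Rightarrow> ('a \<Rightarrow> real) \<Rightarrow> 'a \<Rightarrow> 'a \<Rightarrow> real" where
  "length_dist G l = on_carrier G (\<lambda>x y. l (x \<otimes>\<^bsub>G\<^esub> inv\<^bsub>G\<^esub> y))"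

definition finite_length_group :: "('a, 'm) monoid_scheme \<Rightarrow> ('a \<Rightarrow> real) \<Rightarrow> bool" where
  "finite_length_group G l \<longleftrightarrow>
     group G \<and> finite (carrier G) \<and> invariant_length G l \<and> (\<forall>x\<in>carrier G. l x \<le> 1)"

definition weakly_sofic :: "('a, 'm) monoid_scheme \<Rightarrow> bool" where
  "weakly_sofic G \<longleftrightarrow>
     group G \<and>
     (\<exists>(I :: 'a index set) \<Phi> (H :: 'a index \<Rightarrow> nat monoid) l.
        ultrafilter_on I \<Phi> \<and>
        (\<forall>i\<in>I. finite_length_group (H i) (l i)) \<and>
        (\<exists>f. f \<in> mon G (ultraproduct I \<Phi> H (\<lambda>i. length_dist (H i) (l i)))))"

section \<open>Hyperlinear metric groups\<close>

definition unitary_group :: "nat \<Rightarrow> complex mat monoid" where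
  "unitary_group n =
     \<lparr>carrier = {A \<in> carrier_mat n n. mat_adjoint A * A = 1\<^sub>m n \<and> A * mat_adjoint A = 1\<^sub>m n},
      monoid.mult = (*), one = 1\<^sub>m n\<rparr>"

definition mat_trace :: "complex mat \<Rightarrow> complex" where
  "mat_trace A = (\<Sum>i<dim_row A. A $$ (i, i))"

text \<open>\<^term>\<open>mat_trace (mat_adjoint (u - v) * (u - v))\<close> is real and nonnegative, whence the \<^const>\<open>Re\<close>.\<close>

definition hilbert_schmidt_dist :: "nat \<Rightarrow> complex mat \<Rightarrow> complex mat \<Rightarrow> real" where
  "hilbert_schmidt_dist n =
     on_carrier (unitary_group n)
       (\<lambda>u v. sqrt (1 / real n * Re (mat_trace (mat_adjoint (u - v) * (u - v)))))"

definition hyperlinear :: "('a, 'm) monoid_scheme \<Rightarrow> ('a \<Rightarrow> 'a \<Rightarrow> real) \<Rightarrow> bool" where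
  "hyperlinear G d \<longleftrightarrow>
     complete_metric_group G d \<and>
     (\<exists>(I :: 'a index set) \<Phi> n.
        ultrafilter_on I \<Phi> \<and>
        (\<forall>i\<in>I. 0 < n i) \<and>
        (let H = (\<lambda>i. unitary_group (n i));
             e = (\<lambda>i u v. 1 / 2 * hilbert_schmidt_dist (n i) u v)
         in \<exists>f \<in> hom G (ultraproduct I \<Phi> H e). isometric_on G d (ultra_dist I \<Phi> H e) f))"

section \<open>Ultraproducts are metric groups\<close>

lemma ultrafilter_on_limit:
  fixes f :: "'i \<Rightarrow> real"
  assumes U: "ultrafilter_on I \<Phi>" and f: "\<And>i. i \<in> I \<Longrightarrow> f i \<in> {a..b}"
  shows "\<exists>r\<in>{a..b}. (f \<longlongrightarrow> r) \<Phi>"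
proof -
  have "filtermap f \<Phi> \<noteq> bot"
    using U by (simp add: ultrafilter_on_def filtermap_bot_iff)
  moreover have "eventually (\<lambda>i. i \<in> I) \<Phi>"
    using U by (simp add: ultrafilter_on_def)
  then have "eventually (\<lambda>x. x \<in> {a..b}) (filtermap f \<Phi>)"
    unfolding eventually_filtermap by (rule eventually_mono) (use f in blast)
  ultimately obtain r where r: "r \<in> {a..b}" "inf (nhds r) (filtermap f \<Phi>) \<noteq> bot"
    using compact_Icc[of a b] unfolding compact_filter by blast
  have "(f \<longlongrightarrow> r) \<Phi>"
  proof (rule topological_tendstoI)
    fix S assume S: "open S" "r \<in> S"
    show "eventually (\<lambda>x. f x \<in> S) \<Phi>"
    proof (rule ccontr)
      assume "\<not> ?thesis"
      then have "eventually (\<lambda>x. f x \<notin> S) \<Phi>"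
        using U unfolding ultrafilter_on_def by blast
      then have "eventually (\<lambda>x. x \<notin> S) (filtermap f \<Phi>)"
        by (simp add: eventually_filtermap)
      moreover have "eventually (\<lambda>x. x \<in> S) (nhds r)"
        using S eventually_nhds by blast
      ultimately have "eventually (\<lambda>x. False) (inf (nhds r) (filtermap f \<Phi>))"
        unfolding eventually_inf by blast
      then show False using r(2) by (simp add: trivial_limit_def)
    qed
  qed
  then show ?thesis using r by blast
qed

locale metric_group_family =
  fixes I :: "'i set" and \<Phi> and H :: "'i \<Rightarrow> ('a, 'm) monoid_scheme" and d
  assumes ultrafilter: "ultrafilter_on I \<Phi>"
    and metric: "\<And>i. i \<in> I \<Longrightarrow> bi_invariant_metric_group (H i) (d i)"
begin

abbreviation (input) "P \<equiv> product_group I H"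
abbreviation (input) "N \<equiv> null_sequences I \<Phi> H d"

lemma proper: "\<Phi> \<noteq> bot"
  and ev_I: "eventually (\<lambda>i. i \<in> I) \<Phi>"
  using ultrafilter by (auto simp: ultrafilter_on_def)

lemma tendsto_cong_I:
  "(\<And>i. i \<in> I \<Longrightarrow> f i = g i) \<Longrightarrow> ((f :: 'i \<Rightarrow> real) \<longlongrightarrow> r) \<Phi> \<longleftrightarrow> (g \<longlongrightarrow> r) \<Phi>"
  by (intro tendsto_cong eventually_mono[OF ev_I])

lemma tendsto_0_le:
  assumes "\<And>i. i \<in> I \<Longrightarrow> 0 \<le> f i" "\<And>i. i \<in> I \<Longrightarrow> f i \<le> g i" "((g :: 'i \<Rightarrow> real) \<longlongrightarrow> 0) \<Phi>"
  shows "(f \<longlongrightarrow> 0) \<Phi>"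
proof (rule tendsto_sandwich[of "\<lambda>_. 0" f \<Phi> g])
  show "\<forall>\<^sub>F n in \<Phi>. 0 \<le> f n" "\<forall>\<^sub>F n in \<Phi>. f n \<le> g n"
    using assms by (auto intro: eventually_mono[OF ev_I])
qed (use assms in auto)

lemma grp: "i \<in> I \<Longrightarrow> group (H i)"
  using metric by (simp add: bi_invariant_metric_group_def)

lemma P_group: "group P"
  using grp by simp

lemma P_mem: "x \<in> carrier P \<Longrightarrow> i \<in> I \<Longrightarrow> x i \<in> carrier (H i)"
  by auto

lemma mspace: "i \<in> I \<Longrightarrow> Metric_space (carrier (H i)) (d i)"
  using metric by (simp add: bi_invariant_metric_group_def)

lemma d_nonneg: "i \<in> I \<Longrightarrow> 0 \<le> d i a b"
  by (meson Metric_space.nonneg mspace)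

lemma d_commute: "i \<in> I \<Longrightarrow> d i a b = d i b a"
  by (meson Metric_space.commute mspace)

lemma d_triangle:
  "\<lbrakk>i \<in> I; a \<in> carrier (H i); b \<in> carrier (H i); c \<in> carrier (H i)\<rbrakk> \<Longrightarrow> d i a c \<le> d i a b + d i b c"
  by (meson Metric_space.triangle mspace)

lemma d_refl: "\<lbrakk>i \<in> I; a \<in> carrier (H i)\<rbrakk> \<Longrightarrow> d i a a = 0"
  by (meson Metric_space.zero mspace)

lemma d_left: "\<lbrakk>i \<in> I; a \<in> carrier (H i); b \<in> carrier (H i); c \<in> carrier (H i)\<rbrakk> \<Longrightarrow>
    d i (c \<otimes>\<^bsub>H i\<^esub> a) (c \<otimes>\<^bsub>H i\<^esub> b) = d i a b"
  by (meson bi_invariant_metric_group.left_invariant metric)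

lemma d_right: "\<lbrakk>i \<in> I; a \<in> carrier (H i); b \<in> carrier (H i); c \<in> carrier (H i)\<rbrakk> \<Longrightarrow>
    d i (a \<otimes>\<^bsub>H i\<^esub> c) (b \<otimes>\<^bsub>H i\<^esub> c) = d i a b"
  by (meson bi_invariant_metric_group.right_invariant metric)

lemma d_le_1: "\<lbrakk>i \<in> I; a \<in> carrier (H i); b \<in> carrier (H i)\<rbrakk> \<Longrightarrow> d i a b \<le> 1"
  by (meson bi_invariant_metric_group.dist_le_1 metric)

lemma d_mult_inv: "\<lbrakk>i \<in> I; a \<in> carrier (H i); b \<in> carrier (H i)\<rbrakk> \<Longrightarrow>
    d i (a \<otimes>\<^bsub>H i\<^esub> inv\<^bsub>H i\<^esub> b) \<one>\<^bsub>H i\<^esub> = d i a b"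
  using d_right[of i a b "inv\<^bsub>H i\<^esub> b"] grp[of i] by (simp add: group.r_inv)

lemma limit_exists:
  assumes "x \<in> carrier P" "y \<in> carrier P"
  obtains r where "0 \<le> r" "r \<le> 1" "((\<lambda>i. d i (x i) (y i)) \<longlongrightarrow> r) \<Phi>"
  using ultrafilter_on_limit[OF ultrafilter, of "\<lambda>i. d i (x i) (y i)" 0 1] d_nonneg d_le_1 assms P_mem
  by (metis (no_types, lifting) atLeastAtMost_iff)

lemma mem_null: "x \<in> N \<longleftrightarrow> x \<in> carrier P \<and> ((\<lambda>i. d i (x i) \<one>\<^bsub>H i\<^esub>) \<longlongrightarrow> 0) \<Phi>"
  by (simp add: null_sequences_def)

lemma mult_inv_null:
  assumes "x \<in> carrier P" "y \<in> carrier P"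
  shows "x \<otimes>\<^bsub>P\<^esub> inv\<^bsub>P\<^esub> y \<in> N \<longleftrightarrow> ((\<lambda>i. d i (x i) (y i)) \<longlongrightarrow> 0) \<Phi>"
proof -
  have "x \<otimes>\<^bsub>P\<^esub> inv\<^bsub>P\<^esub> y \<in> carrier P"
    using P_group assms by (metis group.inv_closed group.subgroup_self subgroup.m_closed)
  moreover have "((\<lambda>i. d i ((x \<otimes>\<^bsub>P\<^esub> inv\<^bsub>P\<^esub> y) i) \<one>\<^bsub>H i\<^esub>) \<longlongrightarrow> 0) \<Phi> \<longleftrightarrow> ((\<lambda>i. d i (x i) (y i)) \<longlongrightarrow> 0) \<Phi>"
    using assms grp d_mult_inv P_mem by (intro tendsto_cong_I) (simp add: PiE_mem)
  ultimately show ?thesis unfolding mem_null by blast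
qed

lemma null_normal: "N \<lhd> P"
proof -
  interpret P: group P by (rule P_group)
  have sub: "subgroup N P"
  proof
    show "N \<subseteq> carrier P" by (auto simp: null_sequences_def)
    show "\<one>\<^bsub>P\<^esub> \<in> N"
    proof -
      have "((\<lambda>i. d i (\<one>\<^bsub>P\<^esub> i) \<one>\<^bsub>H i\<^esub>) \<longlongrightarrow> 0) \<Phi> \<longleftrightarrow> ((\<lambda>i. 0) \<longlongrightarrow> (0 :: real)) \<Phi>"
        using grp d_refl by (intro tendsto_cong_I) (simp add: group.is_monoid)
      then show ?thesis unfolding mem_null using P.one_closed by simp
    qed
  next
    fix x y assume xy: "x \<in> N" "y \<in> N"
    then have c: "x \<in> carrier P" "y \<in> carrier P" by (auto simp: mem_null)
    have "((\<lambda>i. d i (x i) \<one>\<^bsub>H i\<^esub> + d i (y i) \<one>\<^bsub>H i\<^esub>) \<longlongrightarrow> 0 + 0) \<Phi>"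
      using xy by (intro tendsto_add) (auto simp: mem_null)
    then have s: "((\<lambda>i. d i (x i) \<one>\<^bsub>H i\<^esub> + d i (y i) \<one>\<^bsub>H i\<^esub>) \<longlongrightarrow> 0) \<Phi>"
      by simp
    have "((\<lambda>i. d i ((x \<otimes>\<^bsub>P\<^esub> y) i) \<one>\<^bsub>H i\<^esub>) \<longlongrightarrow> 0) \<Phi>"
    proof (rule tendsto_0_le[OF _ _ s])
      fix i assume i: "i \<in> I"
      note m = P_mem[OF c(1) i] P_mem[OF c(2) i]
      interpret Hi: group "H i" using grp i .
      have "d i (x i \<otimes>\<^bsub>H i\<^esub> y i) \<one>\<^bsub>H i\<^esub> \<le> d i (x i \<otimes>\<^bsub>H i\<^esub> y i) (y i) + d i (y i) \<one>\<^bsub>H i\<^esub>"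
        using d_triangle i m by simp
      also have "d i (x i \<otimes>\<^bsub>H i\<^esub> y i) (y i) = d i (x i) \<one>\<^bsub>H i\<^esub>"
        using d_right[of i "x i" "\<one>\<^bsub>H i\<^esub>" "y i"] i m by simp
      finally show "d i ((x \<otimes>\<^bsub>P\<^esub> y) i) \<one>\<^bsub>H i\<^esub> \<le> d i (x i) \<one>\<^bsub>H i\<^esub> + d i (y i) \<one>\<^bsub>H i\<^esub>"
        using i by simp
    qed (use d_nonneg in auto)
    then show "x \<otimes>\<^bsub>P\<^esub> y \<in> N" unfolding mem_null using P.m_closed c by blast
  next
    fix x assume x: "x \<in> N"
    then have c: "x \<in> carrier P" by (auto simp: mem_null)
    have "((\<lambda>i. d i (\<one>\<^bsub>P\<^esub> i) (x i)) \<longlongrightarrow> 0) \<Phi> \<longleftrightarrow> ((\<lambda>i. d i (x i) \<one>\<^bsub>H i\<^esub>) \<longlongrightarrow> 0) \<Phi>"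
      using d_commute by (intro tendsto_cong_I) simp
    then have "\<one>\<^bsub>P\<^esub> \<otimes>\<^bsub>P\<^esub> inv\<^bsub>P\<^esub> x \<in> N"
      using mult_inv_null[OF P.one_closed c] x mem_null by blast
    then show "inv\<^bsub>P\<^esub> x \<in> N" using P.inv_closed[OF c] P.l_one by metis
  qed
  show ?thesis
  proof (rule P.normal_inv_iff[THEN iffD2], intro conjI ballI sub)
    fix x h assume x: "x \<in> carrier P" and h: "h \<in> N"
    then have c: "h \<in> carrier P" by (auto simp: mem_null)
    have xh: "x \<otimes>\<^bsub>P\<^esub> h \<in> carrier P" using P.m_closed[OF x c] .
    have "((\<lambda>i. d i ((x \<otimes>\<^bsub>P\<^esub> h) i) (x i)) \<longlongrightarrow> 0) \<Phi> \<longleftrightarrow> ((\<lambda>i. d i (h i) \<one>\<^bsub>H i\<^esub>) \<longlongrightarrow> 0) \<Phi>"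
    proof (intro tendsto_cong_I)
      fix i assume i: "i \<in> I"
      note m = P_mem[OF c i] P_mem[OF x i]
      interpret Hi: group "H i" using grp i .
      show "d i ((x \<otimes>\<^bsub>P\<^esub> h) i) (x i) = d i (h i) \<one>\<^bsub>H i\<^esub>"
        using d_left[of i "h i" "\<one>\<^bsub>H i\<^esub>" "x i"] i m by simp
    qed
    then show "x \<otimes>\<^bsub>P\<^esub> h \<otimes>\<^bsub>P\<^esub> inv\<^bsub>P\<^esub> x \<in> N"
      using mult_inv_null[OF xh x] h mem_null by blast
  qed
qed

lemma group_ultraproduct: "group (ultraproduct I \<Phi> H d)"
  unfolding ultraproduct_def by (rule normal.factorgroup_is_group[OF null_normal])

lemma carrier_ultraproduct: "carrier (ultraproduct I \<Phi> H d) = (\<lambda>x. N #>\<^bsub>P\<^esub> x) ` carrier P"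
  unfolding ultraproduct_def by (rule carrier_FactGroup)

lemma mult_ultraproduct:
  assumes "x \<in> carrier P" "y \<in> carrier P"
  shows "(N #>\<^bsub>P\<^esub> x) \<otimes>\<^bsub>ultraproduct I \<Phi> H d\<^esub> (N #>\<^bsub>P\<^esub> y) = N #>\<^bsub>P\<^esub> (x \<otimes>\<^bsub>P\<^esub> y)"
  unfolding ultraproduct_def mult_FactGroup by (rule normal.rcos_sum[OF null_normal assms])

lemma coset_mem_iff:
  assumes "x \<in> carrier P"
  shows "y \<in> N #>\<^bsub>P\<^esub> x \<longleftrightarrow> y \<in> carrier P \<and> ((\<lambda>i. d i (y i) (x i)) \<longlongrightarrow> 0) \<Phi>"
proof -
  interpret P: group P by (rule P_group)
  have sub: "subgroup N P" using null_normal by (simp add: normal_imp_subgroup)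
  have "y \<in> carrier P \<Longrightarrow> y \<in> N #>\<^bsub>P\<^esub> x \<longleftrightarrow> y \<otimes>\<^bsub>P\<^esub> inv\<^bsub>P\<^esub> x \<in> N"
    using subgroup.rcos_module[OF sub P_group assms] by blast
  moreover have "y \<in> N #>\<^bsub>P\<^esub> x \<Longrightarrow> y \<in> carrier P"
    using P.r_coset_subset_G[OF subgroup.subset[OF sub] assms] by blast
  ultimately show ?thesis using mult_inv_null[OF _ assms] by blast
qed

lemma coset_self: "x \<in> carrier P \<Longrightarrow> x \<in> N #>\<^bsub>P\<^esub> x"
  using normal_imp_subgroup[OF null_normal] P_group by (simp add: group.rcos_self del: carrier_product_group)

lemma coset_eq_iff:
  assumes "x \<in> carrier P" "y \<in> carrier P"
  shows "N #>\<^bsub>P\<^esub> x = N #>\<^bsub>P\<^esub> y \<longleftrightarrow> ((\<lambda>i. d i (x i) (y i)) \<longlongrightarrow> 0) \<Phi>"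
  using group.repr_independence[OF P_group _ assms(2) normal_imp_subgroup[OF null_normal]]
    coset_mem_iff[OF assms(2)] coset_self assms by metis

lemma tendsto_coset:
  assumes c: "x \<in> carrier P" "y \<in> carrier P" and x': "x' \<in> N #>\<^bsub>P\<^esub> x" and y': "y' \<in> N #>\<^bsub>P\<^esub> y"
    and l: "((\<lambda>i. d i (x i) (y i)) \<longlongrightarrow> r) \<Phi>"
  shows "((\<lambda>i. d i (x' i) (y' i)) \<longlongrightarrow> r) \<Phi>"
proof -
  have c': "x' \<in> carrier P" "y' \<in> carrier P" and
    "((\<lambda>i. d i (x' i) (x i)) \<longlongrightarrow> 0) \<Phi>" "((\<lambda>i. d i (y' i) (y i)) \<longlongrightarrow> 0) \<Phi>"
    using coset_mem_iff c x' y' by blast+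
  then have s: "((\<lambda>i. d i (x' i) (x i) + d i (y' i) (y i)) \<longlongrightarrow> 0) \<Phi>"
    using tendsto_add by fastforce
  have "((\<lambda>i. \<bar>d i (x' i) (y' i) - d i (x i) (y i)\<bar>) \<longlongrightarrow> 0) \<Phi>"
  proof (rule tendsto_0_le[OF _ _ s])
    fix i assume i: "i \<in> I"
    note m = P_mem[OF c(1) i] P_mem[OF c(2) i] P_mem[OF c'(1) i] P_mem[OF c'(2) i]
    show "\<bar>d i (x' i) (y' i) - d i (x i) (y i)\<bar> \<le> d i (x' i) (x i) + d i (y' i) (y i)"
      using d_triangle[OF i m(3,1,4)] d_triangle[OF i m(1,2,4)] d_triangle[OF i m(1,3,2)]
        d_triangle[OF i m(3,4,2)] d_commute[OF i, of "x i" "x' i"] d_commute[OF i, of "y i" "y' i"]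
      by linarith
  qed simp
  then have "((\<lambda>i. d i (x' i) (y' i) - d i (x i) (y i)) \<longlongrightarrow> 0) \<Phi>"
    by (rule tendsto_rabs_zero_cancel)
  from tendsto_add[OF this l] show ?thesis by simp
qed

lemma ultra_dist_eq:
  assumes c: "x \<in> carrier P" "y \<in> carrier P" and l: "((\<lambda>i. d i (x i) (y i)) \<longlongrightarrow> r) \<Phi>"
  shows "ultra_dist I \<Phi> H d (N #>\<^bsub>P\<^esub> x) (N #>\<^bsub>P\<^esub> y) = r"
proof -
  have "(THE r. \<forall>x'\<in>N #>\<^bsub>P\<^esub> x. \<forall>y'\<in>N #>\<^bsub>P\<^esub> y. ((\<lambda>i. d i (x' i) (y' i)) \<longlongrightarrow> r) \<Phi>) = r"
  proof (rule the_equality)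
    show "\<forall>x'\<in>N #>\<^bsub>P\<^esub> x. \<forall>y'\<in>N #>\<^bsub>P\<^esub> y. ((\<lambda>i. d i (x' i) (y' i)) \<longlongrightarrow> r) \<Phi>"
      using tendsto_coset[OF c _ _ l] by blast
    fix s assume "\<forall>x'\<in>N #>\<^bsub>P\<^esub> x. \<forall>y'\<in>N #>\<^bsub>P\<^esub> y. ((\<lambda>i. d i (x' i) (y' i)) \<longlongrightarrow> s) \<Phi>"
    then have "((\<lambda>i. d i (x i) (y i)) \<longlongrightarrow> s) \<Phi>" using coset_self c by blast
    then show "s = r" using l tendsto_unique[OF proper] by blast
  qed
  moreover have "N #>\<^bsub>P\<^esub> x \<in> carrier (ultraproduct I \<Phi> H d)" "N #>\<^bsub>P\<^esub> y \<in> carrier (ultraproduct I \<Phi> H d)"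
    using c unfolding carrier_ultraproduct by blast+
  ultimately show ?thesis unfolding ultra_dist_def on_carrier_def by simp
qed

lemma ultra_dist_tendsto:
  assumes "A \<in> carrier (ultraproduct I \<Phi> H d)" "B \<in> carrier (ultraproduct I \<Phi> H d)"
    and "x \<in> A" "y \<in> B"
  shows "((\<lambda>i. d i (x i) (y i)) \<longlongrightarrow> ultra_dist I \<Phi> H d A B) \<Phi>"
proof -
  obtain a b where ab: "a \<in> carrier P" "b \<in> carrier P" "A = N #>\<^bsub>P\<^esub> a" "B = N #>\<^bsub>P\<^esub> b"
    using assms unfolding carrier_ultraproduct by blast
  obtain r where r: "((\<lambda>i. d i (a i) (b i)) \<longlongrightarrow> r) \<Phi>"
    using limit_exists[OF ab(1,2)] by blast
  show ?thesis
    unfolding ab(3,4) ultra_dist_eq[OF ab(1,2) r]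
    by (rule tendsto_coset[OF ab(1,2) assms(3)[unfolded ab] assms(4)[unfolded ab] r])
qed

theorem bi_invariant_ultraproduct:
  "bi_invariant_metric_group (ultraproduct I \<Phi> H d) (ultra_dist I \<Phi> H d)"
proof -
  interpret P: group P by (rule P_group)
  let ?U = "ultraproduct I \<Phi> H d" and ?D = "ultra_dist I \<Phi> H d"
  interpret U: group ?U by (rule group_ultraproduct)
  have obt: "\<exists>x. x \<in> carrier P \<and> A = N #>\<^bsub>P\<^esub> x" if "A \<in> carrier ?U" for A
    using that unfolding carrier_ultraproduct by blast
  have lim: "((\<lambda>i. d i (x i) (y i)) \<longlongrightarrow> ?D (N #>\<^bsub>P\<^esub> x) (N #>\<^bsub>P\<^esub> y)) \<Phi>"
    if "x \<in> carrier P" "y \<in> carrier P" for x y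
    using limit_exists[OF that] ultra_dist_eq[OF that] by metis
  have ev: "eventually Q \<Phi>" if "\<And>i. i \<in> I \<Longrightarrow> Q i" for Q
    using eventually_mono[OF ev_I that] .
  have mult: "((\<lambda>i. d i ((x \<otimes>\<^bsub>P\<^esub> z) i) ((y \<otimes>\<^bsub>P\<^esub> z) i)) \<longlongrightarrow> r) \<Phi>"
    "((\<lambda>i. d i ((z \<otimes>\<^bsub>P\<^esub> x) i) ((z \<otimes>\<^bsub>P\<^esub> y) i)) \<longlongrightarrow> r) \<Phi>"
    if c: "x \<in> carrier P" "y \<in> carrier P" "z \<in> carrier P" and r: "((\<lambda>i. d i (x i) (y i)) \<longlongrightarrow> r) \<Phi>" for x y z r
  proof -
    have e: "d i ((x \<otimes>\<^bsub>P\<^esub> z) i) ((y \<otimes>\<^bsub>P\<^esub> z) i) = d i (x i) (y i)"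
      "d i ((z \<otimes>\<^bsub>P\<^esub> x) i) ((z \<otimes>\<^bsub>P\<^esub> y) i) = d i (x i) (y i)" if i: "i \<in> I" for i
      using d_right[OF i] d_left[OF i] i c P_mem by simp_all
    show "((\<lambda>i. d i ((x \<otimes>\<^bsub>P\<^esub> z) i) ((y \<otimes>\<^bsub>P\<^esub> z) i)) \<longlongrightarrow> r) \<Phi>"
      by (rule tendsto_cong_I[OF e(1), THEN iffD2, OF _ r])
    show "((\<lambda>i. d i ((z \<otimes>\<^bsub>P\<^esub> x) i) ((z \<otimes>\<^bsub>P\<^esub> y) i)) \<longlongrightarrow> r) \<Phi>"
      by (rule tendsto_cong_I[OF e(2), THEN iffD2, OF _ r])
  qed
  have out: "?D A B = 0" if "\<not> (A \<in> carrier ?U \<and> B \<in> carrier ?U)" for A B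
    using that by (auto simp: ultra_dist_def on_carrier_def)
  have nn: "0 \<le> ?D A B" for A B
  proof (cases "A \<in> carrier ?U \<and> B \<in> carrier ?U")
    case True
    then obtain x y where "x \<in> carrier P" "A = N #>\<^bsub>P\<^esub> x" "y \<in> carrier P" "B = N #>\<^bsub>P\<^esub> y"
      using obt by metis
    then show ?thesis
      using tendsto_lowerbound[OF lim[of x y] ev[OF d_nonneg] proper] by blast
  qed (simp add: out)
  have com: "?D A B = ?D B A" for A B
  proof (cases "A \<in> carrier ?U \<and> B \<in> carrier ?U")
    case True
    then obtain x y where *: "x \<in> carrier P" "A = N #>\<^bsub>P\<^esub> x" "y \<in> carrier P" "B = N #>\<^bsub>P\<^esub> y"
      using obt by metis
    have "((\<lambda>i. d i (y i) (x i)) \<longlongrightarrow> ?D A B) \<Phi>"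
      by (rule tendsto_cong_I[OF d_commute, THEN iffD2, OF _ lim[OF *(1,3), folded *(2,4)]])
    then show ?thesis
      by (rule tendsto_unique[OF proper _ lim[OF *(3,1), folded *(2,4)]])
  next
    case False
    then show ?thesis using out by metis
  qed
  show ?thesis
  proof unfold_locales
    fix A B assume "A \<in> carrier ?U" "B \<in> carrier ?U"
    then obtain x y where *: "x \<in> carrier P" "A = N #>\<^bsub>P\<^esub> x" "y \<in> carrier P" "B = N #>\<^bsub>P\<^esub> y"
      using obt by metis
    show "?D A B = 0 \<longleftrightarrow> A = B"
      using coset_eq_iff[OF *(1,3)] ultra_dist_eq[OF *(1,3)] lim[OF *(1,3)] * by metis
    show "?D A B \<le> 1"
      by (rule tendsto_upperbound[OF lim[OF *(1,3), folded *(2,4)] _ proper])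
        (rule ev, rule d_le_1[OF _ P_mem[OF *(1)] P_mem[OF *(3)]])
    fix C assume "C \<in> carrier ?U"
    then obtain z where z: "z \<in> carrier P" "C = N #>\<^bsub>P\<^esub> z" using obt by metis
    show "?D A C \<le> ?D A B + ?D B C"
      by (rule tendsto_le[OF proper tendsto_add[OF lim[OF *(1,3)] lim[OF *(3) z(1)]] lim[OF *(1) z(1)], folded *(2,4) z(2)])
        (rule ev, rule d_triangle[OF _ P_mem[OF *(1)] P_mem[OF *(3)] P_mem[OF z(1)]])
    show "?D (C \<otimes>\<^bsub>?U\<^esub> A) (C \<otimes>\<^bsub>?U\<^esub> B) = ?D A B" "?D (A \<otimes>\<^bsub>?U\<^esub> C) (B \<otimes>\<^bsub>?U\<^esub> C) = ?D A B"
      unfolding *(2,4) z(2) mult_ultraproduct[OF *(1) z(1)] mult_ultraproduct[OF *(3) z(1)]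
        mult_ultraproduct[OF z(1) *(1)] mult_ultraproduct[OF z(1) *(3)]
      by (intro ultra_dist_eq mult P.m_closed *(1,3) z(1) lim)+
  qed (use nn com in auto)
qed

end

lemma bi_invariant_length_dist:
  assumes "group G" "invariant_length G l" "\<And>x. x \<in> carrier G \<Longrightarrow> l x \<le> 1"
  shows "bi_invariant_metric_group G (length_dist G l)"
proof -
  interpret group G by fact
  have l: "0 \<le> l x" "l x = 0 \<longleftrightarrow> x = \<one>\<^bsub>G\<^esub>" "l (inv\<^bsub>G\<^esub> x) = l x"
    "y \<in> carrier G \<Longrightarrow> l (x \<otimes>\<^bsub>G\<^esub> y) \<le> l x + l y"
    "y \<in> carrier G \<Longrightarrow> l (y \<otimes>\<^bsub>G\<^esub> x \<otimes>\<^bsub>G\<^esub> inv\<^bsub>G\<^esub> y) = l x" if "x \<in> carrier G" for x y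
    using assms(2) that unfolding invariant_length_def by blast+
  have D: "length_dist G l x y = l (x \<otimes>\<^bsub>G\<^esub> inv\<^bsub>G\<^esub> y)" if "x \<in> carrier G" "y \<in> carrier G" for x y
    using that by (simp add: length_dist_def on_carrier_def)
  show ?thesis
  proof unfold_locales
    show "0 \<le> length_dist G l x y" for x y
      by (simp add: length_dist_def on_carrier_def l(1))
    have "l (x \<otimes>\<^bsub>G\<^esub> inv\<^bsub>G\<^esub> y) = l (y \<otimes>\<^bsub>G\<^esub> inv\<^bsub>G\<^esub> x)" if "x \<in> carrier G" "y \<in> carrier G" for x y
      using l(3)[of "x \<otimes>\<^bsub>G\<^esub> inv\<^bsub>G\<^esub> y"] that by (simp add: inv_mult_group)
    then show "length_dist G l x y = length_dist G l y x" for x y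
      by (auto simp: length_dist_def on_carrier_def)
    fix x y assume xy: "x \<in> carrier G" "y \<in> carrier G"
    show "length_dist G l x y = 0 \<longleftrightarrow> x = y"
      using xy l(2)[of "x \<otimes>\<^bsub>G\<^esub> inv\<^bsub>G\<^esub> y"] by (simp add: D) (metis inv_solve_right' l_one one_closed)
    show "length_dist G l x y \<le> 1" using xy assms(3) by (simp add: D)
    fix z assume z: "z \<in> carrier G"
    have "(x \<otimes>\<^bsub>G\<^esub> inv\<^bsub>G\<^esub> y) \<otimes>\<^bsub>G\<^esub> (y \<otimes>\<^bsub>G\<^esub> inv\<^bsub>G\<^esub> z) = x \<otimes>\<^bsub>G\<^esub> inv\<^bsub>G\<^esub> z"
      using xy z by (metis inv_closed m_assoc m_closed l_inv l_one)
    then show "length_dist G l x z \<le> length_dist G l x y + length_dist G l y z"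
      using l(4)[of "x \<otimes>\<^bsub>G\<^esub> inv\<^bsub>G\<^esub> y" "y \<otimes>\<^bsub>G\<^esub> inv\<^bsub>G\<^esub> z"] xy z by (simp add: D)
    have "z \<otimes>\<^bsub>G\<^esub> x \<otimes>\<^bsub>G\<^esub> inv\<^bsub>G\<^esub> (z \<otimes>\<^bsub>G\<^esub> y) = z \<otimes>\<^bsub>G\<^esub> (x \<otimes>\<^bsub>G\<^esub> inv\<^bsub>G\<^esub> y) \<otimes>\<^bsub>G\<^esub> inv\<^bsub>G\<^esub> z"
      using xy z by (simp add: inv_mult_group m_assoc)
    then show "length_dist G l (z \<otimes>\<^bsub>G\<^esub> x) (z \<otimes>\<^bsub>G\<^esub> y) = length_dist G l x y"
      using l(5)[of "x \<otimes>\<^bsub>G\<^esub> inv\<^bsub>G\<^esub> y" z] xy z by (simp add: D)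
    have "x \<otimes>\<^bsub>G\<^esub> z \<otimes>\<^bsub>G\<^esub> inv\<^bsub>G\<^esub> (y \<otimes>\<^bsub>G\<^esub> z) = x \<otimes>\<^bsub>G\<^esub> inv\<^bsub>G\<^esub> y"
      using xy z by (simp add: inv_mult_group m_assoc) (simp flip: m_assoc)
    then show "length_dist G l (x \<otimes>\<^bsub>G\<^esub> z) (y \<otimes>\<^bsub>G\<^esub> z) = length_dist G l x y"
      using xy z by (simp add: D)
  qed
qed

section \<open>Unitary groups are metric groups\<close>

lemma mat_adjoint_index:
  fixes A :: "complex mat"
  assumes "i < dim_col A" "j < dim_row A"
  shows "mat_adjoint A $$ (i, j) = cnj (A $$ (j, i))"
  using assms by (simp add: mat_adjoint_def mat_of_rows_def)

lemma mat_adjoint_carrier [simp]: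
  fixes A :: "complex mat"
  shows "A \<in> carrier_mat n m \<Longrightarrow> mat_adjoint A \<in> carrier_mat m n"
  by (auto simp: mat_adjoint_def mat_of_rows_def)

lemma mat_adjoint_dim [simp]:
  fixes A :: "complex mat"
  shows "dim_row (mat_adjoint A) = dim_col A" "dim_col (mat_adjoint A) = dim_row A"
  by (simp_all add: mat_adjoint_def mat_of_rows_def)

lemma mat_adjoint_adjoint:
  fixes A :: "complex mat"
  shows "mat_adjoint (mat_adjoint A) = A"
  by (intro eq_matI) (auto simp: mat_adjoint_index)

lemma mat_adjoint_mult:
  fixes A B :: "complex mat"
  assumes "A \<in> carrier_mat n m" "B \<in> carrier_mat m k"
  shows "mat_adjoint (A * B) = mat_adjoint B * mat_adjoint A"
proof (rule eq_matI)
  have c: "A * B \<in> carrier_mat n k" "mat_adjoint (A * B) \<in> carrier_mat k n"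
    "mat_adjoint A \<in> carrier_mat m n" "mat_adjoint B \<in> carrier_mat k m"
    using assms by auto
  show "dim_row (mat_adjoint (A * B)) = dim_row (mat_adjoint B * mat_adjoint A)"
    "dim_col (mat_adjoint (A * B)) = dim_col (mat_adjoint B * mat_adjoint A)"
    using c by auto
  fix i j assume "i < dim_row (mat_adjoint B * mat_adjoint A)" "j < dim_col (mat_adjoint B * mat_adjoint A)"
  then have ij: "i < k" "j < n" using c by auto
  have "mat_adjoint (A * B) $$ (i, j) = cnj ((A * B) $$ (j, i))"
    using c ij by (intro mat_adjoint_index) auto
  also have "\<dots> = (\<Sum>l = 0..<m. cnj (A $$ (j, l)) * cnj (B $$ (l, i)))"
    using assms ij by (simp add: scalar_prod_def)
  also have "\<dots> = (\<Sum>l = 0..<m. mat_adjoint B $$ (i, l) * mat_adjoint A $$ (l, j))"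
    using assms ij by (intro sum.cong refl) (simp add: mat_adjoint_index)
  also have "\<dots> = (mat_adjoint B * mat_adjoint A) $$ (i, j)"
    using assms c ij by (simp add: scalar_prod_def)
  finally show "mat_adjoint (A * B) $$ (i, j) = (mat_adjoint B * mat_adjoint A) $$ (i, j)" .
qed

lemma mat_trace_comm:
  assumes "A \<in> carrier_mat n m" "B \<in> carrier_mat m n"
  shows "mat_trace (A * B) = mat_trace (B * A)"
proof -
  have "mat_trace (A * B) = (\<Sum>i<n. \<Sum>j<m. A $$ (i, j) * B $$ (j, i))"
    using assms by (simp add: mat_trace_def scalar_prod_def lessThan_atLeast0)
  also have "\<dots> = (\<Sum>j<m. \<Sum>i<n. B $$ (j, i) * A $$ (i, j))"
    by (subst sum.swap) (simp add: mult.commute)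
  also have "\<dots> = mat_trace (B * A)"
    using assms by (simp add: mat_trace_def scalar_prod_def lessThan_atLeast0)
  finally show ?thesis .
qed

lemma mat_trace_adjoint_mult:
  assumes "A \<in> carrier_mat n n"
  shows "mat_trace (mat_adjoint A * A) =
    complex_of_real (\<Sum>p\<in>{..<n} \<times> {..<n}. (cmod (A $$ p))\<^sup>2)"
proof -
  have c: "mat_adjoint A \<in> carrier_mat n n" using assms by simp
  have "mat_trace (mat_adjoint A * A) = (\<Sum>i<n. \<Sum>j<n. mat_adjoint A $$ (i, j) * A $$ (j, i))"
    using assms c by (simp add: mat_trace_def scalar_prod_def lessThan_atLeast0)
  also have "\<dots> = (\<Sum>i<n. \<Sum>j<n. complex_of_real ((cmod (A $$ (j, i)))\<^sup>2))"
    using assms by (intro sum.cong refl) (simp add: mat_adjoint_index complex_norm_square mult.commute del: of_real_power)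
  also have "\<dots> = complex_of_real (\<Sum>j<n. \<Sum>i<n. (cmod (A $$ (j, i)))\<^sup>2)"
    by (subst sum.swap) simp
  finally show ?thesis by (simp add: sum.cartesian_product)
qed

lemma carrier_unitary_group:
  "A \<in> carrier (unitary_group n) \<longleftrightarrow>
     A \<in> carrier_mat n n \<and> mat_adjoint A * A = 1\<^sub>m n \<and> A * mat_adjoint A = 1\<^sub>m n"
  by (simp add: unitary_group_def)

lemma mult_unitary_group [simp]: "A \<otimes>\<^bsub>unitary_group n\<^esub> B = A * B"
  and one_unitary_group [simp]: "\<one>\<^bsub>unitary_group n\<^esub> = 1\<^sub>m n"
  by (simp_all add: unitary_group_def)

lemma group_unitary_group: "group (unitary_group n)"
proof (rule groupI; simp only: mult_unitary_group one_unitary_group)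
  fix A B assume "A \<in> carrier (unitary_group n)" "B \<in> carrier (unitary_group n)"
  then have A: "A \<in> carrier_mat n n" "mat_adjoint A * A = 1\<^sub>m n" "A * mat_adjoint A = 1\<^sub>m n"
    and B: "B \<in> carrier_mat n n" "mat_adjoint B * B = 1\<^sub>m n" "B * mat_adjoint B = 1\<^sub>m n"
    by (auto simp: carrier_unitary_group)
  have A': "mat_adjoint A \<in> carrier_mat n n" and B': "mat_adjoint B \<in> carrier_mat n n"
    using A B by auto
  have "mat_adjoint (A * B) * (A * B) = mat_adjoint B * (mat_adjoint A * A * B)"
    using A(1) B(1) A' B' by (simp add: mat_adjoint_mult assoc_mult_mat[of _ n n _ n _ n])
  moreover have "A * B * mat_adjoint (A * B) = A * (B * mat_adjoint B * mat_adjoint A)"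
    unfolding mat_adjoint_mult[OF A(1) B(1)]
    using assoc_mult_mat[OF A(1) B(1) mult_carrier_mat[OF B' A']] assoc_mult_mat[OF B(1) B' A'] by simp
  ultimately show "A * B \<in> carrier (unitary_group n)"
    using A B A' B' by (simp add: carrier_unitary_group)
next
  have "mat_adjoint (1\<^sub>m n) = (1\<^sub>m n :: complex mat)"
    using mat_adjoint_carrier[of "1\<^sub>m n" n n]
    by (intro eq_matI) (auto simp: mat_adjoint_index)
  then show "1\<^sub>m n \<in> carrier (unitary_group n)" by (simp add: carrier_unitary_group)
next
  fix A assume A: "A \<in> carrier (unitary_group n)"
  then show "1\<^sub>m n * A = A" by (metis carrier_unitary_group left_mult_one_mat)
  show "\<exists>B\<in>carrier (unitary_group n). B * A = 1\<^sub>m n"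
    using A by (intro bexI[of _ "mat_adjoint A"]) (simp_all add: carrier_unitary_group mat_adjoint_adjoint)
next
  fix A B C assume "A \<in> carrier (unitary_group n)" "B \<in> carrier (unitary_group n)" "C \<in> carrier (unitary_group n)"
  then show "A * B * C = A * (B * C)"
    by (simp add: carrier_unitary_group assoc_mult_mat[of _ n n _ n _ n])
qed

lemma hilbert_schmidt_dist_L2:
  assumes "u \<in> carrier (unitary_group n)" "v \<in> carrier (unitary_group n)"
  shows "hilbert_schmidt_dist n u v =
    L2_set (\<lambda>p. cmod (u $$ p - v $$ p)) ({..<n} \<times> {..<n}) / sqrt (real n)"
proof -
  have c: "u \<in> carrier_mat n n" "v \<in> carrier_mat n n"
    using assms by (auto simp: carrier_unitary_group)
  then have "u - v \<in> carrier_mat n n" by auto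
  from mat_trace_adjoint_mult[OF this]
  have "Re (mat_trace (mat_adjoint (u - v) * (u - v))) =
      (\<Sum>p\<in>{..<n} \<times> {..<n}. (cmod ((u - v) $$ p))\<^sup>2)"
    by simp
  also have "\<dots> = (\<Sum>p\<in>{..<n} \<times> {..<n}. (cmod (u $$ p - v $$ p))\<^sup>2)"
    using c by (intro sum.cong refl) auto
  finally show ?thesis
    using assms by (simp add: hilbert_schmidt_dist_def on_carrier_def L2_set_def real_sqrt_divide)
qed

lemma L2_set_unitary:
  assumes "u \<in> carrier (unitary_group n)"
  shows "L2_set (\<lambda>p. cmod (u $$ p)) ({..<n} \<times> {..<n}) = sqrt (real n)"
proof -
  have "complex_of_real (\<Sum>p\<in>{..<n} \<times> {..<n}. (cmod (u $$ p))\<^sup>2) = mat_trace (1\<^sub>m n)"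
    using mat_trace_adjoint_mult[of u n] assms by (simp add: carrier_unitary_group)
  also have "\<dots> = complex_of_real (real n)" by (simp add: mat_trace_def)
  finally have "(\<Sum>p\<in>{..<n} \<times> {..<n}. (cmod (u $$ p))\<^sup>2) = real n"
    unfolding of_real_eq_iff .
  then show ?thesis by (simp add: L2_set_def)
qed

theorem bi_invariant_unitary_group:
  assumes n: "0 < n"
  shows "bi_invariant_metric_group (unitary_group n) (\<lambda>u v. 1 / 2 * hilbert_schmidt_dist n u v)"
proof -
  interpret U: group "unitary_group n" by (rule group_unitary_group)
  let ?S = "{..<n} \<times> {..<n}"
  have fin: "finite ?S" by simp
  show ?thesis
  proof unfold_locales
    have nn: "0 \<le> hilbert_schmidt_dist n u v" for u v
    proof (cases "u \<in> carrier (unitary_group n) \<and> v \<in> carrier (unitary_group n)")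
      case True then show ?thesis by (simp add: hilbert_schmidt_dist_L2 L2_set_nonneg)
    next
      case False then show ?thesis by (auto simp: hilbert_schmidt_dist_def on_carrier_def)
    qed
    then show "0 \<le> 1 / 2 * hilbert_schmidt_dist n u v" for u v by simp
    have "hilbert_schmidt_dist n u v = hilbert_schmidt_dist n v u" for u v
    proof (cases "u \<in> carrier (unitary_group n) \<and> v \<in> carrier (unitary_group n)")
      case True then show ?thesis by (simp add: hilbert_schmidt_dist_L2 norm_minus_commute)
    next
      case False then show ?thesis by (auto simp: hilbert_schmidt_dist_def on_carrier_def)
    qed
    then show "1 / 2 * hilbert_schmidt_dist n u v = 1 / 2 * hilbert_schmidt_dist n v u" for u v by simp
    fix u v assume uv: "u \<in> carrier (unitary_group n)" "v \<in> carrier (unitary_group n)"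
    then have c: "u \<in> carrier_mat n n" "v \<in> carrier_mat n n" by (auto simp: carrier_unitary_group)
    have "hilbert_schmidt_dist n u v = 0 \<longleftrightarrow> (\<forall>p\<in>?S. u $$ p = v $$ p)"
      using n by (simp add: hilbert_schmidt_dist_L2 uv L2_set_eq_0_iff)
    also have "\<dots> \<longleftrightarrow> u = v"
      using c by (auto intro!: eq_matI)
    finally show "1 / 2 * hilbert_schmidt_dist n u v = 0 \<longleftrightarrow> u = v" by simp
    have "L2_set (\<lambda>p. cmod (u $$ p - v $$ p)) ?S \<le> L2_set (\<lambda>p. cmod (u $$ p) + cmod (v $$ p)) ?S"
      by (intro L2_set_mono norm_triangle_ineq4) simp
    also have "\<dots> \<le> L2_set (\<lambda>p. cmod (u $$ p)) ?S + L2_set (\<lambda>p. cmod (v $$ p)) ?S"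
      by (rule L2_set_triangle_ineq)
    also have "\<dots> = 2 * sqrt (real n)" using L2_set_unitary uv by simp
    finally show "1 / 2 * hilbert_schmidt_dist n u v \<le> 1"
      using n by (simp add: hilbert_schmidt_dist_L2 uv divide_simps)
    fix w assume w: "w \<in> carrier (unitary_group n)"
    have cw: "w \<in> carrier_mat n n" and ww: "mat_adjoint w * w = 1\<^sub>m n" "w * mat_adjoint w = 1\<^sub>m n"
      and cw': "mat_adjoint w \<in> carrier_mat n n"
      using w by (auto simp: carrier_unitary_group)
    have "L2_set (\<lambda>p. cmod (u $$ p - w $$ p)) ?S
        \<le> L2_set (\<lambda>p. cmod (u $$ p - v $$ p) + cmod (v $$ p - w $$ p)) ?S"
      by (intro L2_set_mono norm_diff_triangle_le[OF order_refl order_refl]) simp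
    also have "\<dots> \<le> L2_set (\<lambda>p. cmod (u $$ p - v $$ p)) ?S + L2_set (\<lambda>p. cmod (v $$ p - w $$ p)) ?S"
      by (rule L2_set_triangle_ineq)
    finally show "1 / 2 * hilbert_schmidt_dist n u w \<le>
        1 / 2 * hilbert_schmidt_dist n u v + 1 / 2 * hilbert_schmidt_dist n v w"
      using n by (simp add: hilbert_schmidt_dist_L2 uv w divide_simps)
    define a where "a = u - v"
    have a: "a \<in> carrier_mat n n" "mat_adjoint a \<in> carrier_mat n n" using c by (auto simp: a_def)
    have "mat_adjoint (w * a) * (w * a) = mat_adjoint a * (mat_adjoint w * w * a)"
      using a cw cw' by (simp add: mat_adjoint_mult assoc_mult_mat[of _ n n _ n _ n])
    also have "\<dots> = mat_adjoint a * a" using ww a by simp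
    finally have 1: "mat_adjoint (w * a) * (w * a) = mat_adjoint a * a" .
    have "mat_trace (mat_adjoint (a * w) * (a * w)) = mat_trace (mat_adjoint w * (mat_adjoint a * a * w))"
      using a cw cw' by (simp add: mat_adjoint_mult assoc_mult_mat[of _ n n _ n _ n])
    also have "\<dots> = mat_trace (mat_adjoint a * a * w * mat_adjoint w)"
      using a cw cw' by (intro mat_trace_comm) auto
    also have "mat_adjoint a * a * w * mat_adjoint w = mat_adjoint a * a * (w * mat_adjoint w)"
      using a cw cw' by (intro assoc_mult_mat) auto
    also have "\<dots> = mat_adjoint a * a" using ww a by simp
    finally have 2: "mat_trace (mat_adjoint (a * w) * (a * w)) = mat_trace (mat_adjoint a * a)" .
    have 3: "w * u - w * v = w * a" "u * w - v * w = a * w"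
      using c cw by (simp_all add: a_def mult_minus_distrib_mat[of _ n n] minus_mult_distrib_mat[of _ n n])
    have 4: "w * u \<in> carrier (unitary_group n)" "w * v \<in> carrier (unitary_group n)"
      "u * w \<in> carrier (unitary_group n)" "v * w \<in> carrier (unitary_group n)"
      using U.m_closed uv w by auto
    show "1 / 2 * hilbert_schmidt_dist n (w \<otimes>\<^bsub>unitary_group n\<^esub> u) (w \<otimes>\<^bsub>unitary_group n\<^esub> v)
        = 1 / 2 * hilbert_schmidt_dist n u v"
      using uv 4 by (simp add: hilbert_schmidt_dist_def on_carrier_def 3 1 flip: a_def)
    show "1 / 2 * hilbert_schmidt_dist n (u \<otimes>\<^bsub>unitary_group n\<^esub> w) (v \<otimes>\<^bsub>unitary_group n\<^esub> w)
        = 1 / 2 * hilbert_schmidt_dist n u v"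
      using uv 4 by (simp add: hilbert_schmidt_dist_def on_carrier_def 3 2 flip: a_def)
  qed
qed

section \<open>Independence of the index type\<close>

lemma ultrafilter_below:
  assumes "F \<noteq> bot"
  shows "\<exists>\<Phi>\<le>F. ultrafilter_on UNIV \<Phi>"
proof -
  let ?A = "{G. G \<noteq> bot \<and> G \<le> F}"
  have "\<exists>m\<in>?A. \<forall>G\<in>?A. m \<ge> G \<longrightarrow> G = m"
  proof (rule predicate_Zorn)
    show "partial_order_on ?A (relation_of (\<ge>) ?A)"
      by (rule partial_order_on_relation_ofI) auto
    fix C assume C: "C \<in> Chains (relation_of (\<ge>) ?A)"
    show "\<exists>u\<in>?A. \<forall>G\<in>C. G \<ge> u"
    proof (cases "C = {}")
      case True
      then show ?thesis using assms by auto
    next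
      case False
      have CA: "C \<subseteq> ?A" and chain: "\<And>G G'. G \<in> C \<Longrightarrow> G' \<in> C \<Longrightarrow> G \<le> G' \<or> G' \<le> G"
        using C by (auto simp: Chains_def relation_of_def)
      have "\<not> eventually (\<lambda>_. False) (Inf C)"
        using False CA by (subst eventually_Inf_base) (auto simp: trivial_limit_def, use chain in blast)
      then have "Inf C \<noteq> bot" by (simp add: trivial_limit_def)
      moreover have "Inf C \<le> F"
      proof -
        obtain G where "G \<in> C" using False by blast
        then show ?thesis using CA by (intro Inf_lower2[of G]) auto
      qed
      ultimately show ?thesis
        by (intro bexI[of _ "Inf C"] ballI Inf_lower) simp_all
    qed
  qed
  then obtain m where m: "m \<noteq> bot" "m \<le> F" and max: "\<And>G. G \<noteq> bot \<Longrightarrow> G \<le> F \<Longrightarrow> G \<le> m \<Longrightarrow> G = m"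
    by blast
  have "eventually P m \<or> eventually (\<lambda>x. \<not> P x) m" for P
  proof (rule disjCI)
    assume "\<not> eventually (\<lambda>x. \<not> P x) m"
    then have "inf m (principal {x. P x}) \<noteq> bot"
      by (simp add: trivial_limit_def eventually_inf_principal)
    then have eq: "inf m (principal {x. P x}) = m"
      using m by (intro max) (auto intro: le_infI1)
    have "eventually P (inf m (principal {x. P x}))"
      by (simp add: eventually_inf_principal)
    then show "eventually P m" by (simp only: eq)
  qed
  then show ?thesis using m by (auto simp: ultrafilter_on_def)
qed

lemma reindex_limits:
  fixes a b :: "'i \<Rightarrow> 'a \<Rightarrow> 'a \<Rightarrow> real"
  assumes U: "ultrafilter_on I \<Phi>"
    and a: "\<And>g h. g \<in> S \<Longrightarrow> h \<in> S \<Longrightarrow> ((\<lambda>i. a i g h) \<longlongrightarrow> A g h) \<Phi>"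
    and b: "\<And>g h. g \<in> S \<Longrightarrow> h \<in> S \<Longrightarrow> ((\<lambda>i. b i g h) \<longlongrightarrow> B g h) \<Phi>"
  obtains s \<Psi> where "ultrafilter_on UNIV \<Psi>" "\<And>j :: 'a index. s j \<in> I"
    "\<And>g h. g \<in> S \<Longrightarrow> h \<in> S \<Longrightarrow> ((\<lambda>j. a (s j) g h) \<longlongrightarrow> A g h) \<Psi>"
    "\<And>g h. g \<in> S \<Longrightarrow> h \<in> S \<Longrightarrow> ((\<lambda>j. b (s j) g h) \<longlongrightarrow> B g h) \<Psi>"
proof -
  define Q where "Q = (\<lambda>F n i. \<forall>g\<in>F \<inter> S. \<forall>h\<in>F \<inter> S.
    \<bar>a i g h - A g h\<bar> < inverse (real (Suc n)) \<and> \<bar>b i g h - B g h\<bar> < inverse (real (Suc n)))"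
  have I: "eventually (\<lambda>i. i \<in> I) \<Phi>" and nb: "\<Phi> \<noteq> bot"
    using U by (auto simp: ultrafilter_on_def)
  have "\<exists>i\<in>I. finite (fst j) \<longrightarrow> Q (fst j) (snd j) i" for j
  proof (cases "finite (fst j)")
    case True
    have "eventually (\<lambda>i. \<bar>a i g h - A g h\<bar> < inverse (real (Suc n)) \<and>
        \<bar>b i g h - B g h\<bar> < inverse (real (Suc n))) \<Phi>" if "g \<in> S" "h \<in> S" for g h n
      using tendstoD[OF a[OF that], of "inverse (real (Suc n))"] tendstoD[OF b[OF that], of "inverse (real (Suc n))"]
      by (auto simp: dist_real_def intro: eventually_conj)
    then have "eventually (Q (fst j) (snd j)) \<Phi>"
      unfolding Q_def using True by (intro eventually_ball_finite ballI) auto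
    then have "eventually (\<lambda>i. i \<in> I \<and> Q (fst j) (snd j) i) \<Phi>" using I by (rule eventually_conj[rotated])
    then show ?thesis using eventually_happens'[OF nb] by blast
  next
    case False
    then show ?thesis using eventually_happens'[OF nb I] by blast
  qed
  then obtain s where s: "\<And>j. s j \<in> I" "\<And>j. finite (fst j) \<Longrightarrow> Q (fst j) (snd j) (s j)" by metis
  define F0 where "F0 = (finite_subsets_at_top (UNIV :: 'a set) \<times>\<^sub>F sequentially)"
  have "F0 \<noteq> bot" by (simp add: F0_def prod_filter_eq_bot)
  then obtain \<Psi> where \<Psi>: "\<Psi> \<le> F0" "ultrafilter_on UNIV \<Psi>" using ultrafilter_below by blast
  have near: "eventually (\<lambda>j. \<bar>a (s j) g h - A g h\<bar> < e \<and> \<bar>b (s j) g h - B g h\<bar> < e) \<Psi>"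
    if gh: "g \<in> S" "h \<in> S" and e: "0 < e" for g h e
  proof (rule filter_leD[OF \<Psi>(1)])
    obtain N where N: "inverse (real (Suc N)) < e" using reals_Archimedean[OF e] by blast
    have 1: "eventually (\<lambda>F. finite F \<and> {g, h} \<subseteq> F) (finite_subsets_at_top UNIV)"
      unfolding eventually_finite_subsets_at_top by (intro exI[of _ "{g, h}"]) auto
    have "eventually (\<lambda>j. (finite (fst j) \<and> {g, h} \<subseteq> fst j) \<and> N \<le> snd j) F0"
      unfolding F0_def case_prod_beta[symmetric]
      using eventually_prodI[OF 1 eventually_ge_at_top[of N]] by (simp add: case_prod_beta)
    then show "eventually (\<lambda>j. \<bar>a (s j) g h - A g h\<bar> < e \<and> \<bar>b (s j) g h - B g h\<bar> < e) F0"
    proof (rule eventually_mono)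
      fix j assume j: "(finite (fst j) \<and> {g, h} \<subseteq> fst j) \<and> N \<le> snd j"
      then have "inverse (real (Suc (snd j))) \<le> inverse (real (Suc N))"
        by (intro le_imp_inverse_le) auto
      then have "inverse (real (Suc (snd j))) < e" using N by linarith
      moreover have "\<bar>a (s j) g h - A g h\<bar> < inverse (real (Suc (snd j)))"
        "\<bar>b (s j) g h - B g h\<bar> < inverse (real (Suc (snd j)))"
        using s(2)[of j] j gh unfolding Q_def by blast+
      ultimately show "\<bar>a (s j) g h - A g h\<bar> < e \<and> \<bar>b (s j) g h - B g h\<bar> < e" by linarith
    qed
  qed
  show thesis
  proof (rule that[OF \<Psi>(2) s(1)])
    fix g h assume gh: "g \<in> S" "h \<in> S"
    show "((\<lambda>j. a (s j) g h) \<longlongrightarrow> A g h) \<Psi>" "((\<lambda>j. b (s j) g h) \<longlongrightarrow> B g h) \<Psi>"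
      by (auto intro!: tendstoI intro: eventually_mono[OF near[OF gh]] simp: dist_real_def)
  qed
qed

context metric_group_family
begin

lemma hom_ultraproduct_limits:
  assumes f: "f \<in> hom G (ultraproduct I \<Phi> H d)" and G: "group G"
  obtains \<phi> where "\<And>i g. i \<in> I \<Longrightarrow> g \<in> carrier G \<Longrightarrow> \<phi> i g \<in> carrier (H i)"
    "\<And>g h. g \<in> carrier G \<Longrightarrow> h \<in> carrier G \<Longrightarrow>
       ((\<lambda>i. d i (\<phi> i (g \<otimes>\<^bsub>G\<^esub> h)) (\<phi> i g \<otimes>\<^bsub>H i\<^esub> \<phi> i h)) \<longlongrightarrow> 0) \<Phi>"
    "\<And>g h. g \<in> carrier G \<Longrightarrow> h \<in> carrier G \<Longrightarrow>
       ((\<lambda>i. d i (\<phi> i g) (\<phi> i h)) \<longlongrightarrow> ultra_dist I \<Phi> H d (f g) (f h)) \<Phi>"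
proof -
  have fc: "f g \<in> carrier (ultraproduct I \<Phi> H d)" if "g \<in> carrier G" for g
    using f that by (auto simp: hom_def)
  then have "\<exists>x. x \<in> carrier P \<and> f g = N #>\<^bsub>P\<^esub> x" if "g \<in> carrier G" for g
    using that unfolding carrier_ultraproduct by blast
  then obtain \<rho> where \<rho>: "\<And>g. g \<in> carrier G \<Longrightarrow> \<rho> g \<in> carrier P"
    "\<And>g. g \<in> carrier G \<Longrightarrow> f g = N #>\<^bsub>P\<^esub> \<rho> g" by metis
  show thesis
  proof (rule that[of "\<lambda>i g. \<rho> g i"])
    show "\<rho> g i \<in> carrier (H i)" if "i \<in> I" "g \<in> carrier G" for i g
      using P_mem[OF \<rho>(1)] that by blast
    fix g h assume gh: "g \<in> carrier G" "h \<in> carrier G"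
    then have gh': "g \<otimes>\<^bsub>G\<^esub> h \<in> carrier G" using G by (simp add: group.is_monoid monoid.m_closed)
    show "((\<lambda>i. d i (\<rho> g i) (\<rho> h i)) \<longlongrightarrow> ultra_dist I \<Phi> H d (f g) (f h)) \<Phi>"
      by (rule ultra_dist_tendsto[OF fc[OF gh(1)] fc[OF gh(2)]])
        (use coset_self[OF \<rho>(1)] \<rho>(2) gh in metis)+
    have m: "\<rho> g \<otimes>\<^bsub>P\<^esub> \<rho> h \<in> carrier P"
      using P_group \<rho>(1) gh by (metis group.is_monoid monoid.m_closed)
    have "f (g \<otimes>\<^bsub>G\<^esub> h) = N #>\<^bsub>P\<^esub> (\<rho> g \<otimes>\<^bsub>P\<^esub> \<rho> h)"
      using f gh mult_ultraproduct[OF \<rho>(1)[OF gh(1)] \<rho>(1)[OF gh(2)]] \<rho>(2) by (simp add: hom_def)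
    then have "((\<lambda>i. d i (\<rho> (g \<otimes>\<^bsub>G\<^esub> h) i) ((\<rho> g \<otimes>\<^bsub>P\<^esub> \<rho> h) i)) \<longlongrightarrow> 0) \<Phi>"
      using coset_eq_iff[OF \<rho>(1)[OF gh'] m] \<rho>(2)[OF gh'] by metis
    then show "((\<lambda>i. d i (\<rho> (g \<otimes>\<^bsub>G\<^esub> h) i) (\<rho> g i \<otimes>\<^bsub>H i\<^esub> \<rho> h i)) \<longlongrightarrow> 0) \<Phi>"
      by (rule tendsto_cong_I[THEN iffD1, rotated]) simp
  qed
qed

lemma limits_hom_ultraproduct:
  assumes G: "group G"
    and \<phi>: "\<And>i g. i \<in> I \<Longrightarrow> g \<in> carrier G \<Longrightarrow> \<phi> i g \<in> carrier (H i)"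
    and mult: "\<And>g h. g \<in> carrier G \<Longrightarrow> h \<in> carrier G \<Longrightarrow>
       ((\<lambda>i. d i (\<phi> i (g \<otimes>\<^bsub>G\<^esub> h)) (\<phi> i g \<otimes>\<^bsub>H i\<^esub> \<phi> i h)) \<longlongrightarrow> 0) \<Phi>"
    and dist: "\<And>g h. g \<in> carrier G \<Longrightarrow> h \<in> carrier G \<Longrightarrow>
       ((\<lambda>i. d i (\<phi> i g) (\<phi> i h)) \<longlongrightarrow> D g h) \<Phi>"
  obtains f where "f \<in> hom G (ultraproduct I \<Phi> H d)"
    "\<And>g h. g \<in> carrier G \<Longrightarrow> h \<in> carrier G \<Longrightarrow> ultra_dist I \<Phi> H d (f g) (f h) = D g h"
proof -
  define \<rho> where "\<rho> = (\<lambda>g. \<lambda>i\<in>I. \<phi> i g)"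
  have \<rho>: "\<rho> g \<in> carrier P" if "g \<in> carrier G" for g
    using \<phi> that by (auto simp: \<rho>_def)
  show thesis
  proof (rule that[of "\<lambda>g. N #>\<^bsub>P\<^esub> \<rho> g"])
    show "(\<lambda>g. N #>\<^bsub>P\<^esub> \<rho> g) \<in> hom G (ultraproduct I \<Phi> H d)"
    proof (rule homI)
      show "N #>\<^bsub>P\<^esub> \<rho> g \<in> carrier (ultraproduct I \<Phi> H d)" if "g \<in> carrier G" for g
        using \<rho>[OF that] unfolding carrier_ultraproduct by blast
      fix g h assume gh: "g \<in> carrier G" "h \<in> carrier G"
      then have gh': "g \<otimes>\<^bsub>G\<^esub> h \<in> carrier G" using G by (simp add: group.is_monoid monoid.m_closed)
      have m: "\<rho> g \<otimes>\<^bsub>P\<^esub> \<rho> h \<in> carrier P"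
        using P_group \<rho> gh by (metis group.is_monoid monoid.m_closed)
      have "((\<lambda>i. d i (\<rho> (g \<otimes>\<^bsub>G\<^esub> h) i) ((\<rho> g \<otimes>\<^bsub>P\<^esub> \<rho> h) i)) \<longlongrightarrow> 0) \<Phi>"
        by (rule tendsto_cong_I[THEN iffD2, OF _ mult[OF gh]]) (simp add: \<rho>_def)
      then show "N #>\<^bsub>P\<^esub> \<rho> (g \<otimes>\<^bsub>G\<^esub> h) =
          (N #>\<^bsub>P\<^esub> \<rho> g) \<otimes>\<^bsub>ultraproduct I \<Phi> H d\<^esub> (N #>\<^bsub>P\<^esub> \<rho> h)"
        using coset_eq_iff[OF \<rho>[OF gh'] m] mult_ultraproduct[OF \<rho>[OF gh(1)] \<rho>[OF gh(2)]] by metis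
    qed
    fix g h assume gh: "g \<in> carrier G" "h \<in> carrier G"
    show "ultra_dist I \<Phi> H d (N #>\<^bsub>P\<^esub> \<rho> g) (N #>\<^bsub>P\<^esub> \<rho> h) = D g h"
      by (rule ultra_dist_eq[OF \<rho>[OF gh(1)] \<rho>[OF gh(2)]],
          rule tendsto_cong_I[THEN iffD2, OF _ dist[OF gh]]) (simp add: \<rho>_def)
  qed
qed

end

theorem hyperlinear_if_embeds:
  fixes G :: "('a, 'm) monoid_scheme" and I :: "'i set" and n :: "'i \<Rightarrow> nat"
  defines "H \<equiv> \<lambda>i. unitary_group (n i)"
    and "e \<equiv> \<lambda>i u v. 1 / 2 * hilbert_schmidt_dist (n i) u v"
  assumes G: "complete_metric_group G d"
    and U: "ultrafilter_on I \<Phi>" and n: "\<And>i. i \<in> I \<Longrightarrow> 0 < n i"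
    and f: "f \<in> hom G (ultraproduct I \<Phi> H e)" "isometric_on G d (ultra_dist I \<Phi> H e) f"
  shows "hyperlinear G d"
proof -
  have grp: "group G"
    using G by (simp add: complete_metric_group_def bi_invariant_metric_group_def)
  interpret F: metric_group_family I \<Phi> H e
    unfolding H_def e_def by (rule metric_group_family.intro[OF U bi_invariant_unitary_group[OF n]])
  obtain \<phi> where \<phi>: "\<And>i g. i \<in> I \<Longrightarrow> g \<in> carrier G \<Longrightarrow> \<phi> i g \<in> carrier (H i)"
    "\<And>g h. g \<in> carrier G \<Longrightarrow> h \<in> carrier G \<Longrightarrow>
       ((\<lambda>i. e i (\<phi> i (g \<otimes>\<^bsub>G\<^esub> h)) (\<phi> i g \<otimes>\<^bsub>H i\<^esub> \<phi> i h)) \<longlongrightarrow> 0) \<Phi>"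
    "\<And>g h. g \<in> carrier G \<Longrightarrow> h \<in> carrier G \<Longrightarrow>
       ((\<lambda>i. e i (\<phi> i g) (\<phi> i h)) \<longlongrightarrow> ultra_dist I \<Phi> H e (f g) (f h)) \<Phi>"
    using F.hom_ultraproduct_limits[OF f(1) grp] by blast
  obtain s \<Psi> where s: "ultrafilter_on UNIV \<Psi>" "\<And>j :: 'a index. s j \<in> I"
    "\<And>g h. g \<in> carrier G \<Longrightarrow> h \<in> carrier G \<Longrightarrow>
      ((\<lambda>j. e (s j) (\<phi> (s j) (g \<otimes>\<^bsub>G\<^esub> h)) (\<phi> (s j) g \<otimes>\<^bsub>H (s j)\<^esub> \<phi> (s j) h)) \<longlongrightarrow> 0) \<Psi>"
    "\<And>g h. g \<in> carrier G \<Longrightarrow> h \<in> carrier G \<Longrightarrow>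
      ((\<lambda>j. e (s j) (\<phi> (s j) g) (\<phi> (s j) h)) \<longlongrightarrow> ultra_dist I \<Phi> H e (f g) (f h)) \<Psi>"
    apply (rule reindex_limits[where S = "carrier G"
        and a = "\<lambda>i g h. e i (\<phi> i (g \<otimes>\<^bsub>G\<^esub> h)) (\<phi> i g \<otimes>\<^bsub>H i\<^esub> \<phi> i h)" and A = "\<lambda>_ _. 0"
        and b = "\<lambda>i g h. e i (\<phi> i g) (\<phi> i h)" and B = "\<lambda>g h. ultra_dist I \<Phi> H e (f g) (f h)",
        OF U])
      apply (erule (1) \<phi>(2))
     apply (erule (1) \<phi>(3))
    by (rule that; assumption)
  interpret S: metric_group_family UNIV \<Psi> "\<lambda>j. H (s j)" "\<lambda>j. e (s j)"
    by (rule metric_group_family.intro[OF s(1) F.metric[OF s(2)]])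
  obtain f' where f': "f' \<in> hom G (ultraproduct UNIV \<Psi> (\<lambda>j. H (s j)) (\<lambda>j. e (s j)))"
    "\<And>g h. g \<in> carrier G \<Longrightarrow> h \<in> carrier G \<Longrightarrow>
      ultra_dist UNIV \<Psi> (\<lambda>j. H (s j)) (\<lambda>j. e (s j)) (f' g) (f' h) = ultra_dist I \<Phi> H e (f g) (f h)"
    using S.limits_hom_ultraproduct[OF grp \<phi>(1)[OF s(2)] s(3,4)] by blast
  have "isometric_on G d (ultra_dist UNIV \<Psi> (\<lambda>j. H (s j)) (\<lambda>j. e (s j))) f'"
    using f' f(2) by (simp add: isometric_on_def)
  then have "\<exists>f\<in>hom G (ultraproduct UNIV \<Psi> (\<lambda>j. H (s j)) (\<lambda>j. e (s j))).
      isometric_on G d (ultra_dist UNIV \<Psi> (\<lambda>j. H (s j)) (\<lambda>j. e (s j))) f"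
    using f'(1) by blast
  then show ?thesis
    unfolding hyperlinear_def Let_def H_def e_def
    by (intro conjI exI[of _ UNIV] exI[of _ \<Psi>] exI[of _ "\<lambda>j. n (s j)"] ballI G s(1) n s(2))
qed

lemma finite_length_group_nat:
  fixes G :: "('a, 'm) monoid_scheme"
  assumes "finite_length_group G l"
  obtains \<theta> :: "'a \<Rightarrow> nat" and K :: "nat monoid" and k where "finite_length_group K k" "\<theta> \<in> hom G K"
    "\<And>x y. x \<in> carrier G \<Longrightarrow> y \<in> carrier G \<Longrightarrow> length_dist K k (\<theta> x) (\<theta> y) = length_dist G l x y"
proof -
  have G: "group G" and fin: "finite (carrier G)" and l: "invariant_length G l" "\<And>x. x \<in> carrier G \<Longrightarrow> l x \<le> 1"
    using assms by (auto simp: finite_length_group_def)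
  interpret G: group G by (rule G)
  obtain \<theta> :: "'a \<Rightarrow> nat" where inj: "inj_on \<theta> (carrier G)"
    using finite_imp_inj_to_nat_seg[OF fin] by blast
  define K where "K = image_group \<theta> G"
  have K: "group K" unfolding K_def by (rule G.inj_imp_image_group_is_group[OF inj])
  have iso: "\<theta> \<in> iso G K" unfolding K_def by (rule inj_imp_image_group_iso[OF inj])
  interpret h: group_hom G K \<theta>
    using G K iso by (simp add: group_hom_def group_hom_axioms_def iso_def)
  define k where "k = (\<lambda>y. l (inv_into (carrier G) \<theta> y))"
  have k: "k (\<theta> x) = l x" if "x \<in> carrier G" for x
    using that inj by (simp add: k_def)
  have carr: "carrier K = \<theta> ` carrier G" by (simp add: K_def image_group_carrier)
  have one: "\<theta> x = \<one>\<^bsub>K\<^esub> \<longleftrightarrow> x = \<one>\<^bsub>G\<^esub>" if "x \<in> carrier G" for x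
    using inj that by (metis G.one_closed h.hom_one inj_onD)
  have il: "invariant_length K k"
    using l(1) unfolding invariant_length_def carr
    by (auto simp: k one simp flip: h.hom_inv h.hom_mult)
  have "finite_length_group K k"
    using K fin il l(2) by (auto simp: finite_length_group_def carr k)
  moreover have "\<theta> \<in> hom G K" using iso by (simp add: iso_def)
  moreover have "length_dist K k (\<theta> x) (\<theta> y) = length_dist G l x y" if "x \<in> carrier G" "y \<in> carrier G" for x y
    using that by (simp add: length_dist_def on_carrier_def k flip: h.hom_inv h.hom_mult)
  ultimately show thesis by (rule that)
qed

theorem weakly_sofic_if_embeds:
  fixes G :: "('a, 'm) monoid_scheme" and I :: "'i set" and H :: "'i \<Rightarrow> ('h, 'n) monoid_scheme" and l
  defines "e \<equiv> \<lambda>i. length_dist (H i) (l i)"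
  assumes grp: "group G"
    and U: "ultrafilter_on I \<Phi>" and H: "\<And>i. i \<in> I \<Longrightarrow> finite_length_group (H i) (l i)"
    and f: "f \<in> mon G (ultraproduct I \<Phi> H e)"
  shows "weakly_sofic G"
proof -
  have met: "bi_invariant_metric_group K (length_dist K k)" if "finite_length_group K k" for K :: "('k, 'o) monoid_scheme" and k
    using that bi_invariant_length_dist unfolding finite_length_group_def by blast
  interpret F: metric_group_family I \<Phi> H e
    unfolding e_def by (rule metric_group_family.intro[OF U met[OF H]])
  have fh: "f \<in> hom G (ultraproduct I \<Phi> H e)" and finj: "inj_on f (carrier G)"
    using f by (auto simp: mon_def)
  obtain \<phi> where \<phi>: "\<And>i g. i \<in> I \<Longrightarrow> g \<in> carrier G \<Longrightarrow> \<phi> i g \<in> carrier (H i)"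
    "\<And>g h. g \<in> carrier G \<Longrightarrow> h \<in> carrier G \<Longrightarrow>
       ((\<lambda>i. e i (\<phi> i (g \<otimes>\<^bsub>G\<^esub> h)) (\<phi> i g \<otimes>\<^bsub>H i\<^esub> \<phi> i h)) \<longlongrightarrow> 0) \<Phi>"
    "\<And>g h. g \<in> carrier G \<Longrightarrow> h \<in> carrier G \<Longrightarrow>
       ((\<lambda>i. e i (\<phi> i g) (\<phi> i h)) \<longlongrightarrow> ultra_dist I \<Phi> H e (f g) (f h)) \<Phi>"
    using F.hom_ultraproduct_limits[OF fh grp] by blast
  obtain s \<Psi> where s: "ultrafilter_on UNIV \<Psi>" "\<And>j :: 'a index. s j \<in> I"
    "\<And>g h. g \<in> carrier G \<Longrightarrow> h \<in> carrier G \<Longrightarrow>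
      ((\<lambda>j. e (s j) (\<phi> (s j) (g \<otimes>\<^bsub>G\<^esub> h)) (\<phi> (s j) g \<otimes>\<^bsub>H (s j)\<^esub> \<phi> (s j) h)) \<longlongrightarrow> 0) \<Psi>"
    "\<And>g h. g \<in> carrier G \<Longrightarrow> h \<in> carrier G \<Longrightarrow>
      ((\<lambda>j. e (s j) (\<phi> (s j) g) (\<phi> (s j) h)) \<longlongrightarrow> ultra_dist I \<Phi> H e (f g) (f h)) \<Psi>"
    apply (rule reindex_limits[where S = "carrier G"
        and a = "\<lambda>i g h. e i (\<phi> i (g \<otimes>\<^bsub>G\<^esub> h)) (\<phi> i g \<otimes>\<^bsub>H i\<^esub> \<phi> i h)" and A = "\<lambda>_ _. 0"
        and b = "\<lambda>i g h. e i (\<phi> i g) (\<phi> i h)" and B = "\<lambda>g h. ultra_dist I \<Phi> H e (f g) (f h)",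
        OF U])
      apply (erule (1) \<phi>(2))
     apply (erule (1) \<phi>(3))
    by (rule that; assumption)
  have "\<exists>(K :: nat monoid) k \<theta>. finite_length_group K k \<and> \<theta> \<in> hom (H (s j)) K \<and>
      (\<forall>x\<in>carrier (H (s j)). \<forall>y\<in>carrier (H (s j)). length_dist K k (\<theta> x) (\<theta> y) = e (s j) x y)" for j
    using finite_length_group_nat[OF H[OF s(2)[of j]]] unfolding e_def by metis
  then obtain K :: "'a index \<Rightarrow> nat monoid" and k \<theta> where
    K: "\<And>j. finite_length_group (K j) (k j)" "\<And>j. \<theta> j \<in> hom (H (s j)) (K j)"
    "\<And>j x y. x \<in> carrier (H (s j)) \<Longrightarrow> y \<in> carrier (H (s j)) \<Longrightarrow>
       length_dist (K j) (k j) (\<theta> j x) (\<theta> j y) = e (s j) x y"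
    by metis
  define c where "c = (\<lambda>j. length_dist (K j) (k j))"
  interpret S: metric_group_family UNIV \<Psi> K c
    unfolding c_def by (rule metric_group_family.intro[OF s(1) met[OF K(1)]])
  have \<phi>s: "\<phi> (s j) g \<in> carrier (H (s j))" if "g \<in> carrier G" for g j
    using \<phi>(1)[OF s(2) that] .
  have c: "c j (\<theta> j (\<phi> (s j) g)) (\<theta> j (\<phi> (s j) h)) = e (s j) (\<phi> (s j) g) (\<phi> (s j) h)"
    if "g \<in> carrier G" "h \<in> carrier G" for g h j
    unfolding c_def by (rule K(3)[OF \<phi>s \<phi>s]) (use that in auto)
  have c': "c j (\<theta> j (\<phi> (s j) (g \<otimes>\<^bsub>G\<^esub> h))) (\<theta> j (\<phi> (s j) g) \<otimes>\<^bsub>K j\<^esub> \<theta> j (\<phi> (s j) h)) =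
      e (s j) (\<phi> (s j) (g \<otimes>\<^bsub>G\<^esub> h)) (\<phi> (s j) g \<otimes>\<^bsub>H (s j)\<^esub> \<phi> (s j) h)"
    if gh: "g \<in> carrier G" "h \<in> carrier G" for g h j
  proof -
    have "g \<otimes>\<^bsub>G\<^esub> h \<in> carrier G" using gh grp by (simp add: group.is_monoid monoid.m_closed)
    moreover have "\<phi> (s j) g \<otimes>\<^bsub>H (s j)\<^esub> \<phi> (s j) h \<in> carrier (H (s j))"
      using \<phi>s gh F.grp[OF s(2)] by (simp add: group.is_monoid monoid.m_closed)
    ultimately show ?thesis
      unfolding c_def hom_mult[OF K(2) \<phi>s[OF gh(1)] \<phi>s[OF gh(2)], symmetric]
      by (intro K(3) \<phi>s)
  qed
  obtain f' where f': "f' \<in> hom G (ultraproduct UNIV \<Psi> K c)"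
    "\<And>g h. g \<in> carrier G \<Longrightarrow> h \<in> carrier G \<Longrightarrow>
      ultra_dist UNIV \<Psi> K c (f' g) (f' h) = ultra_dist I \<Phi> H e (f g) (f h)"
  proof (rule S.limits_hom_ultraproduct[OF grp, where D = "\<lambda>g h. ultra_dist I \<Phi> H e (f g) (f h)"
        and \<phi> = "\<lambda>j g. \<theta> j (\<phi> (s j) g)"])
    show "\<theta> j (\<phi> (s j) g) \<in> carrier (K j)" if "g \<in> carrier G" for j g
      using hom_in_carrier[OF K(2) \<phi>s[OF that]] .
  qed (simp_all add: c c' s(3,4) that)
  interpret V: bi_invariant_metric_group "ultraproduct I \<Phi> H e" "ultra_dist I \<Phi> H e"
    by (rule F.bi_invariant_ultraproduct)
  interpret W: bi_invariant_metric_group "ultraproduct UNIV \<Psi> K c" "ultra_dist UNIV \<Psi> K c"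
    by (rule S.bi_invariant_ultraproduct)
  have "inj_on f' (carrier G)"
  proof (rule inj_onI)
    fix g h assume gh: "g \<in> carrier G" "h \<in> carrier G" "f' g = f' h"
    then have "ultra_dist I \<Phi> H e (f g) (f h) = 0"
      using f'(2)[OF gh(1,2)] W.mdist_zero[OF hom_in_carrier[OF f'(1) gh(2)]] by simp
    then have "f g = f h"
      using V.zero[OF hom_in_carrier[OF fh gh(1)] hom_in_carrier[OF fh gh(2)]] by blast
    then show "g = h" using finj gh by (auto dest: inj_onD)
  qed
  then have "f' \<in> mon G (ultraproduct UNIV \<Psi> K c)" using f'(1) by (simp add: mon_def)
  then show ?thesis
    unfolding weakly_sofic_def c_def
    by (intro conjI grp exI[of _ UNIV] exI[of _ \<Psi>] exI[of _ K] exI[of _ k] exI[of _ f'] ballI s(1) K(1))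
qed

end

theory Submission
  imports Defs "HOL-Analysis.Cartesian_Euclidean_Space"
begin

text \<open>
  The approximating discrete groups are copies of \<open>G\<close> itself, only the metric varies.  Put
  \<open>d\<^sub>k = sqrt ((k d\<^sup>2 + [x \<noteq> y] / 2) / (k + 1))\<close>.  Each \<open>d\<^sub>k\<close> is bi-invariant and keeps distinct points
  at least \<open>sqrt (1 / (2 (k + 1)))\<close> apart, and \<open>d\<^sub>k \<longlonglongrightarrow> d\<close> pointwise.  Along a nonprincipal
  ultrafilter the diagonal map from \<open>(G, d)\<close> into the ultraproduct of the \<open>(G, d\<^sub>k)\<close> is therefore an isometric homomorphism, and
  its image is closed because \<open>G\<close> is complete (\<open>pointwise_limit_closed_subgroup\<close>).  As the groups do not
  change, weak soficity passes to all of them at once.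

  For the hyperlinear case the same \<open>d\<^sub>k\<close> works (\<open>hyperlinear_separated_dist\<close>), and this is why it
  is a quadratic mean and not, say, a maximum.  For unitary matrices the square of half the
  Hilbert--Schmidt distance is \<open>(1 - Re t) / 2\<close>, where \<open>t\<close> is the normalized trace of \<open>u\<^sup>* v\<close>, and so it
  is averaged by direct sums.  The representation \<open>u \<mapsto> (1 \<oplus> u)\<^bsup>\<otimes>m\<^esup>\<close> turns \<open>t\<close> into \<open>((1 + t) / 2)\<^sup>m\<close>, which
  tends to \<open>0\<close> as \<open>m\<close> grows whenever \<open>\<bar>t\<bar> \<le> 1\<close> and \<open>t \<noteq> 1\<close>, so in the limit it puts all distinct points
  at squared distance \<open>1 / 2\<close>.  A direct sum of copies of \<open>u\<close> and of this tensor power, with weights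
  \<open>k : 1\<close>, has normalized trace \<open>(k t + ((1 + t) / 2)\<^sup>m) / (k + 1)\<close>.  Composing approximate
  representations of \<open>(G, d)\<close> with it and letting first the approximation improve and then \<open>m\<close> tend to
  infinity realizes exactly \<open>d\<^sub>k\<close>.
\<close>

section \<open>Discrete metrics approximating a metric\<close>

definition separated_dist :: "('a \<Rightarrow> 'a \<Rightarrow> real) \<Rightarrow> nat \<Rightarrow> 'a \<Rightarrow> 'a \<Rightarrow> real" where
  "separated_dist d k x y = sqrt ((real k * (d x y)\<^sup>2 + (if x = y then 0 else 1 / 2)) / real (Suc k))"

text \<open>
  A uniform gap makes Cauchy sequences eventually constant; completeness is needed besides
  discreteness because it is part of the definition of hyperlinearity.
\<close>

lemma uniformly_discrete:
  assumes M: "bi_invariant_metric_group G d" and c: "0 < c"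
    and sep: "\<And>x y. x \<in> carrier G \<Longrightarrow> y \<in> carrier G \<Longrightarrow> x \<noteq> y \<Longrightarrow> c \<le> d x y"
  shows "discrete_metric_group G d" "complete_metric_group G d"
proof -
  interpret bi_invariant_metric_group G d by fact
  have "openin mtopology {x}" if x: "x \<in> carrier G" for x
  proof -
    have "mball x c = {x}"
    proof
      show "mball x c \<subseteq> {x}" using sep[OF x] by (force simp: in_mball)
    qed (use x c in simp)
    then show ?thesis by (metis openin_mball)
  qed
  then have "mtopology = discrete_topology (carrier G)"
    by (metis discrete_topology_unique topspace_mtopology)
  then show "discrete_metric_group G d" using M by (simp add: discrete_metric_group_def)
  have "mcomplete"
    unfolding mcomplete_def
  proof (intro allI impI)
    fix \<sigma> :: "nat \<Rightarrow> 'a" assume \<sigma>: "MCauchy \<sigma>"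
    then have r: "\<sigma> n \<in> carrier G" for n by (auto simp: MCauchy_def)
    obtain N where N: "\<And>n n'. N \<le> n \<Longrightarrow> N \<le> n' \<Longrightarrow> d (\<sigma> n) (\<sigma> n') < c"
      using \<sigma> c unfolding MCauchy_def by meson
    have "\<sigma> n = \<sigma> N" if "N \<le> n" for n
      using sep[OF r r, of n N] N[OF that order_refl] by linarith
    then have "eventually (\<lambda>n. \<sigma> n = \<sigma> N) sequentially"
      unfolding eventually_sequentially by blast
    then have "limitin mtopology \<sigma> (\<sigma> N) sequentially"
      using r by (intro limitin_eventually) auto
    then show "\<exists>x. limitin mtopology \<sigma> x sequentially" by blast
  qed
  then show "complete_metric_group G d" using M by (simp add: complete_metric_group_def)
qed

text \<open>
  Exhibits the distance as the Euclidean norm of a pair of pseudometrics, which gives the triangle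
  inequality below.
\<close>

lemma separated_dist_sqrt_sum:
  assumes "0 \<le> d x y"
  shows "separated_dist d k x y =
    sqrt ((sqrt (k / Suc k) * d x y)\<^sup>2 + (if x = y then 0 else sqrt (1 / (2 * real (Suc k))))\<^sup>2)"
  by (cases "x = y") (simp_all add: separated_dist_def power_mult_distrib add_divide_distrib del: of_nat_Suc)

lemma separated_dist_tendsto:
  assumes "0 \<le> d x y" "x = y \<Longrightarrow> d x y = 0"
  shows "(\<lambda>k. separated_dist d k x y) \<longlonglongrightarrow> d x y"
proof -
  have 1: "(\<lambda>k. inverse (real (Suc k))) \<longlonglongrightarrow> 0"
    by (rule LIMSEQ_inverse_real_of_nat)
  have eq: "separated_dist d k x y = sqrt ((1 - inverse (real (Suc k))) * (d x y)\<^sup>2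
        + inverse (real (Suc k)) * (if x = y then 0 else 1 / 2))" for k
  proof -
    have *: "real k / real (Suc k) = 1 - inverse (real (Suc k))" by (simp add: field_simps)
    show ?thesis
      unfolding separated_dist_def add_divide_distrib *[symmetric]
      by (simp only: divide_inverse mult_ac)
  qed
  have "(\<lambda>k. separated_dist d k x y) \<longlonglongrightarrow> sqrt ((1 - 0) * (d x y)\<^sup>2 + 0 * (if x = y then 0 else 1 / 2))"
    unfolding eq by (intro tendsto_intros 1)
  then show ?thesis using assms(1) by simp
qed

lemma bi_invariant_separated_dist:
  assumes "bi_invariant_metric_group G d"
  shows "bi_invariant_metric_group G (separated_dist d k)"
proof -
  interpret bi_invariant_metric_group G d by fact
  define a where "a = sqrt (k / Suc k)"
  define b where "b = (\<lambda>x y :: 'a. if x = y then 0 else sqrt (1 / (2 * real (Suc k))))"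
  have S: "separated_dist d k x y = sqrt ((a * d x y)\<^sup>2 + (b x y)\<^sup>2)" for x y
    unfolding a_def b_def by (rule separated_dist_sqrt_sum) simp
  have a: "0 \<le> a" and b: "0 \<le> b x y" "b x z \<le> b x y + b y z" for x y z
    by (auto simp: a_def b_def)
  show ?thesis
  proof unfold_locales
    show "0 \<le> separated_dist d k x y" for x y by (simp add: S)
    show "separated_dist d k x y = separated_dist d k y x" for x y
      by (simp add: separated_dist_def commute eq_commute)
    fix x y assume xy: "x \<in> carrier G" "y \<in> carrier G"
    show "separated_dist d k x y = 0 \<longleftrightarrow> x = y"
      using xy by (auto simp: separated_dist_def add_nonneg_eq_0_iff)
    have "real k * (d x y)\<^sup>2 \<le> real k * 1\<^sup>2"
      using dist_le_1[OF xy] by (intro mult_left_mono power_mono) auto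
    then have "real k * (d x y)\<^sup>2 + (if x = y then 0 else 1 / 2) \<le> real (Suc k)" by auto
    then show "separated_dist d k x y \<le> 1" by (simp add: separated_dist_def del: of_nat_Suc)
    fix z assume z: "z \<in> carrier G"
    have "separated_dist d k x z \<le> sqrt ((a * d x y + a * d y z)\<^sup>2 + (b x y + b y z)\<^sup>2)"
      unfolding S
    proof (intro real_sqrt_le_mono add_mono power_mono b)
      show "a * d x z \<le> a * d x y + a * d y z"
        unfolding distrib_left[symmetric] by (rule mult_left_mono[OF triangle[OF xy z] a])
      show "0 \<le> a * d x z" using a by simp
    qed
    also have "\<dots> \<le> separated_dist d k x y + separated_dist d k y z"
      unfolding S by (rule real_sqrt_sum_squares_triangle_ineq)
    finally show "separated_dist d k x z \<le> separated_dist d k x y + separated_dist d k y z" .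
    show "separated_dist d k (z \<otimes>\<^bsub>G\<^esub> x) (z \<otimes>\<^bsub>G\<^esub> y) = separated_dist d k x y"
      "separated_dist d k (x \<otimes>\<^bsub>G\<^esub> z) (y \<otimes>\<^bsub>G\<^esub> z) = separated_dist d k x y"
      using xy z by (simp_all add: separated_dist_def left_invariant right_invariant)
  qed
qed

lemma separated_dist_discrete_complete:
  assumes "bi_invariant_metric_group G d"
  shows "discrete_metric_group G (separated_dist d k)" "complete_metric_group G (separated_dist d k)"
proof -
  have sep: "sqrt (1 / (2 * real (Suc k))) \<le> separated_dist d k x y" if "x \<noteq> y" for x y
    using that by (simp add: separated_dist_def divide_simps)
  show "discrete_metric_group G (separated_dist d k)" "complete_metric_group G (separated_dist d k)"
    using uniformly_discrete[OF bi_invariant_separated_dist[OF assms] _ sep] by simp_all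
qed

section \<open>The diagonal embedding\<close>

text \<open>
  The image is isometric to the complete space \<open>G\<close>, and a complete subspace is closed.
\<close>

lemma complete_isometric_hom_closed:
  assumes G: "complete_metric_group G d" and U: "bi_invariant_metric_group U e"
    and f: "f \<in> hom G U" "isometric_on G d e f"
  shows "iso_to_closed_subgroup G d U e"
proof -
  interpret G: bi_invariant_metric_group G d using G by (simp add: complete_metric_group_def)
  interpret U: bi_invariant_metric_group U e by fact
  interpret f: group_hom G U f
    using f(1) by unfold_locales
  let ?K = "f ` carrier G"
  have iso: "e (f x) (f y) = d x y" if "x \<in> carrier G" "y \<in> carrier G" for x y
    using f(2) that by (simp add: isometric_on_def)
  have inj: "inj_on f (carrier G)"
    by (rule inj_onI) (metis G.zero U.mdist_zero f.hom_closed iso)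
  have K: "?K \<subseteq> carrier U" using f(1) by (auto simp: hom_def)
  interpret S: Submetric "carrier U" e ?K
    using K by unfold_locales
  have "S.sub.mcomplete"
    unfolding S.sub.mcomplete_def
  proof (intro allI impI)
    fix \<sigma> assume \<sigma>: "S.sub.MCauchy \<sigma>"
    then have "\<sigma> n \<in> f ` carrier G" for n unfolding S.sub.MCauchy_def by blast
    then have "\<forall>n. \<exists>x\<in>carrier G. \<sigma> n = f x" by blast
    then obtain \<tau> where \<tau>: "\<And>n. \<tau> n \<in> carrier G" "\<And>n. \<sigma> n = f (\<tau> n)" by metis
    have "G.MCauchy \<tau>"
      using \<sigma> \<tau> unfolding G.MCauchy_def S.sub.MCauchy_def by (simp add: iso image_subset_iff)
    then obtain x where x: "limitin G.mtopology \<tau> x sequentially"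
      using G unfolding complete_metric_group_def G.mcomplete_def by blast
    then have xG: "x \<in> carrier G" by (simp add: G.limitin_metric)
    have "limitin S.sub.mtopology \<sigma> (f x) sequentially"
      using x \<tau>(1) xG unfolding G.limitin_metric S.sub.limitin_metric \<tau>(2) by (simp add: iso)
    then show "\<exists>y. limitin S.sub.mtopology \<sigma> y sequentially" by blast
  qed
  then have "closedin U.mtopology ?K" by (rule S.mcomplete_imp_closedin)
  moreover have "f \<in> iso G (U\<lparr>carrier := ?K\<rparr>)"
    using f(1) inj by (auto simp: iso_def hom_def bij_betw_def)
  ultimately show ?thesis
    unfolding iso_to_closed_subgroup_def
    by (intro exI[of _ ?K] conjI bexI[of _ f] f.img_is_subgroup f(2))
qed

text \<open>
  The diagonal map is the embedding: the distance of two constant families in the ultraproduct is the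
  limit of their distances, that is \<open>d\<close>.
\<close>

lemma pointwise_limit_closed_subgroup:
  fixes G :: "('a, 'm) monoid_scheme"
  assumes G: "complete_metric_group G d" and U: "ultrafilter_on I \<Phi>"
    and e: "\<And>i. i \<in> I \<Longrightarrow> bi_invariant_metric_group G (e i)"
    and lim: "\<And>x y. x \<in> carrier G \<Longrightarrow> y \<in> carrier G \<Longrightarrow> ((\<lambda>i. e i x y) \<longlongrightarrow> d x y) \<Phi>"
  shows "iso_to_closed_subgroup G d (ultraproduct I \<Phi> (\<lambda>_. G) e) (ultra_dist I \<Phi> (\<lambda>_. G) e)"
proof -
  interpret G: bi_invariant_metric_group G d using G by (simp add: complete_metric_group_def)
  interpret F: metric_group_family I \<Phi> "\<lambda>_. G" e by (rule metric_group_family.intro[OF U e])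
  have "((\<lambda>i. e i (x \<otimes>\<^bsub>G\<^esub> y) (x \<otimes>\<^bsub>G\<^esub> y)) \<longlongrightarrow> 0) \<Phi>" if "x \<in> carrier G" "y \<in> carrier G" for x y
    using lim[of "x \<otimes>\<^bsub>G\<^esub> y" "x \<otimes>\<^bsub>G\<^esub> y"] that by simp
  then obtain f where f: "f \<in> hom G (ultraproduct I \<Phi> (\<lambda>_. G) e)"
    "\<And>x y. x \<in> carrier G \<Longrightarrow> y \<in> carrier G \<Longrightarrow> ultra_dist I \<Phi> (\<lambda>_. G) e (f x) (f y) = d x y"
    using F.limits_hom_ultraproduct[where \<phi> = "\<lambda>_ x. x" and D = d, OF G.is_group _ _ lim] by blast
  show ?thesis
    by (rule complete_isometric_hom_closed[OF G F.bi_invariant_ultraproduct f(1)])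
      (simp add: isometric_on_def f(2))
qed

section \<open>Characters of unitary groups\<close>

definition direct_sum :: "complex mat \<Rightarrow> complex mat \<Rightarrow> complex mat" where
  "direct_sum A B = four_block_mat A (0\<^sub>m (dim_row A) (dim_col B)) (0\<^sub>m (dim_row B) (dim_col A)) B"

text \<open>
  The basis vector \<open>e\<^sub>p \<otimes> e\<^sub>q\<close> is numbered \<open>p * dim_row B + q\<close>.
\<close>

definition kronecker :: "complex mat \<Rightarrow> complex mat \<Rightarrow> complex mat" where
  "kronecker A B = mat (dim_row A * dim_row B) (dim_col A * dim_col B)
     (\<lambda>(i, j). A $$ (i div dim_row B, j div dim_col B) * B $$ (i mod dim_row B, j mod dim_col B))"

lemma inv_unitary_group:
  assumes "u \<in> carrier (unitary_group n)"
  shows "inv\<^bsub>unitary_group n\<^esub> u = mat_adjoint u"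
  using assms by (intro group.inv_equality[OF group_unitary_group])
    (simp_all add: carrier_unitary_group mat_adjoint_adjoint)

lemma hom_unitary_adjoint:
  assumes D: "D \<in> hom (unitary_group n) (unitary_group N)" and u: "u \<in> carrier (unitary_group n)"
  shows "D (mat_adjoint u) = mat_adjoint (D u)"
proof -
  interpret D: group_hom "unitary_group n" "unitary_group N" D
    using D by (simp add: group_hom_def group_hom_axioms_def group_unitary_group)
  show ?thesis
    using D.hom_inv[OF u] inv_unitary_group[OF u] inv_unitary_group[OF D.hom_closed[OF u]] by simp
qed

text \<open>
  Unitarity of the values follows from multiplicativity once adjoints are preserved: apply \<open>D\<close> to
  \<open>u\<^sup>* u = 1\<close>.
\<close>

lemma unitary_group_homI:
  assumes carr: "\<And>u. u \<in> carrier (unitary_group n) \<Longrightarrow> D u \<in> carrier_mat N N"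
    and adj: "\<And>u. u \<in> carrier (unitary_group n) \<Longrightarrow> D (mat_adjoint u) = mat_adjoint (D u)"
    and mult: "\<And>u v. u \<in> carrier (unitary_group n) \<Longrightarrow> v \<in> carrier (unitary_group n) \<Longrightarrow> D (u * v) = D u * D v"
    and one: "D (1\<^sub>m n) = 1\<^sub>m N"
  shows "D \<in> hom (unitary_group n) (unitary_group N)"
proof (rule homI)
  fix u assume u: "u \<in> carrier (unitary_group n)"
  then have u': "mat_adjoint u \<in> carrier (unitary_group n)"
    by (simp add: carrier_unitary_group mat_adjoint_adjoint)
  have "mat_adjoint (D u) * D u = 1\<^sub>m N" "D u * mat_adjoint (D u) = 1\<^sub>m N"
    using u mult[OF u u'] mult[OF u' u] adj[OF u] one by (simp_all add: carrier_unitary_group)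
  then show "D u \<in> carrier (unitary_group N)"
    using carr[OF u] by (simp add: carrier_unitary_group)
qed (simp add: mult)

lemma direct_sum_carrier [simp]:
  "A \<in> carrier_mat n n \<Longrightarrow> B \<in> carrier_mat m m \<Longrightarrow> direct_sum A B \<in> carrier_mat (n + m) (n + m)"
  by (simp add: direct_sum_def)

lemma direct_sum_adjoint:
  assumes "A \<in> carrier_mat n n" "B \<in> carrier_mat m m"
  shows "direct_sum (mat_adjoint A) (mat_adjoint B) = mat_adjoint (direct_sum A B)"
  by (rule eq_matI) (use assms in \<open>auto simp: direct_sum_def mat_adjoint_index\<close>)

lemma direct_sum_mult:
  assumes "A \<in> carrier_mat n n" "B \<in> carrier_mat m m" "C \<in> carrier_mat n n" "D \<in> carrier_mat m m"
  shows "direct_sum (A * C) (B * D) = direct_sum A B * direct_sum C D"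
  unfolding direct_sum_def using assms
  by (subst mult_four_block_mat[of _ n n _ m _ m _ _ n _ m]) auto

lemma direct_sum_one: "direct_sum (1\<^sub>m n) (1\<^sub>m m) = 1\<^sub>m (n + m)"
  by (simp add: direct_sum_def)

lemma mat_trace_direct_sum:
  assumes "A \<in> carrier_mat n n" "B \<in> carrier_mat m m"
  shows "mat_trace (direct_sum A B) = mat_trace A + mat_trace B"
proof -
  have split: "(\<Sum>i<n + m. f i) = (\<Sum>i<n. f i) + (\<Sum>i<m. f (n + i))" for f :: "nat \<Rightarrow> complex"
    by (induction m) (simp_all add: add.assoc)
  show ?thesis
    using assms by (simp add: mat_trace_def direct_sum_def split)
qed

lemma kronecker_carrier [simp]:
  "A \<in> carrier_mat n n \<Longrightarrow> B \<in> carrier_mat m m \<Longrightarrow> kronecker A B \<in> carrier_mat (n * m) (n * m)"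
  by (simp add: kronecker_def)

lemma kronecker_index:
  assumes "A \<in> carrier_mat n n" "B \<in> carrier_mat m m" "i < n * m" "j < n * m"
  shows "kronecker A B $$ (i, j) = A $$ (i div m, j div m) * B $$ (i mod m, j mod m)"
  using assms by (simp add: kronecker_def)

lemma div_mod_less:
  fixes i :: nat
  assumes "i < n * m"
  shows "i div m < n" "i mod m < m"
proof -
  have "0 < m" using assms by (cases m) auto
  then show "i div m < n" "i mod m < m" using assms by (simp_all add: less_mult_imp_div_less)
qed

lemma kronecker_adjoint:
  assumes "A \<in> carrier_mat n n" "B \<in> carrier_mat m m"
  shows "kronecker (mat_adjoint A) (mat_adjoint B) = mat_adjoint (kronecker A B)"
proof (rule eq_matI)
  have c: "kronecker A B \<in> carrier_mat (n * m) (n * m)" using assms by simp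
  then show "dim_row (kronecker (mat_adjoint A) (mat_adjoint B)) = dim_row (mat_adjoint (kronecker A B))"
    "dim_col (kronecker (mat_adjoint A) (mat_adjoint B)) = dim_col (mat_adjoint (kronecker A B))"
    using assms by (auto simp: kronecker_def)
  fix i j assume "i < dim_row (mat_adjoint (kronecker A B))" "j < dim_col (mat_adjoint (kronecker A B))"
  then have ij: "i < n * m" "j < n * m" using c by auto
  then show "kronecker (mat_adjoint A) (mat_adjoint B) $$ (i, j) = mat_adjoint (kronecker A B) $$ (i, j)"
    using assms carrier_matD[OF c] div_mod_less[OF ij(1)] div_mod_less[OF ij(2)]
    by (simp add: kronecker_index[of _ n _ m] mat_adjoint_index)
qed

lemma kronecker_mult:
  assumes "A \<in> carrier_mat n n" "B \<in> carrier_mat m m" "C \<in> carrier_mat n n" "D \<in> carrier_mat m m"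
  shows "kronecker (A * C) (B * D) = kronecker A B * kronecker C D"
proof (rule eq_matI)
  have c: "kronecker A B \<in> carrier_mat (n * m) (n * m)" "kronecker C D \<in> carrier_mat (n * m) (n * m)"
    "kronecker (A * C) (B * D) \<in> carrier_mat (n * m) (n * m)"
    using assms by (auto intro: kronecker_carrier)
  then show "dim_row (kronecker (A * C) (B * D)) = dim_row (kronecker A B * kronecker C D)"
    "dim_col (kronecker (A * C) (B * D)) = dim_col (kronecker A B * kronecker C D)" by auto
  fix i j assume "i < dim_row (kronecker A B * kronecker C D)" "j < dim_col (kronecker A B * kronecker C D)"
  then have ij: "i < n * m" "j < n * m" using c by auto
  note dm = div_mod_less[OF ij(1)] div_mod_less[OF ij(2)]
  have "(kronecker A B * kronecker C D) $$ (i, j) = (\<Sum>l<n * m. kronecker A B $$ (i, l) * kronecker C D $$ (l, j))"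
    using c ij by (simp add: scalar_prod_def lessThan_atLeast0)
  also have "\<dots> = (\<Sum>l<n * m. (A $$ (i div m, l div m) * B $$ (i mod m, l mod m)) *
      (C $$ (l div m, j div m) * D $$ (l mod m, j mod m)))"
    using assms ij by (intro sum.cong refl) (simp add: kronecker_index[of _ n _ m])
  also have "\<dots> = (\<Sum>p<n. \<Sum>q<m. (A $$ (i div m, p) * C $$ (p, j div m)) * (B $$ (i mod m, q) * D $$ (q, j mod m)))"
    unfolding sum_mult_product by (intro sum.cong refl) (simp add: mult_ac)
  also have "\<dots> = (A * C) $$ (i div m, j div m) * (B * D) $$ (i mod m, j mod m)"
    using assms dm by (simp add: scalar_prod_def lessThan_atLeast0 sum_product)
  also have "\<dots> = kronecker (A * C) (B * D) $$ (i, j)"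
    using assms ij by (intro kronecker_index[symmetric]) auto
  finally show "kronecker (A * C) (B * D) $$ (i, j) = (kronecker A B * kronecker C D) $$ (i, j)" ..
qed

lemma kronecker_one: "kronecker (1\<^sub>m n) (1\<^sub>m m) = 1\<^sub>m (n * m)"
proof (rule eq_matI)
  fix i j assume "i < dim_row (1\<^sub>m (n * m))" "j < dim_col (1\<^sub>m (n * m))"
  then have ij: "i < n * m" "j < n * m" by auto
  have "i = j \<longleftrightarrow> i div m = j div m \<and> i mod m = j mod m"
    by (metis div_mult_mod_eq)
  then show "kronecker (1\<^sub>m n) (1\<^sub>m m) $$ (i, j) = 1\<^sub>m (n * m) $$ (i, j)"
    using ij div_mod_less[OF ij(1)] div_mod_less[OF ij(2)]
    by (subst kronecker_index[of _ n _ m]) auto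
qed (simp_all add: kronecker_def)

lemma mat_trace_kronecker:
  assumes "A \<in> carrier_mat n n" "B \<in> carrier_mat m m"
  shows "mat_trace (kronecker A B) = mat_trace A * mat_trace B"
proof -
  have "mat_trace (kronecker A B) = (\<Sum>i<n * m. A $$ (i div m, i div m) * B $$ (i mod m, i mod m))"
    using assms by (simp add: mat_trace_def kronecker_def)
  also have "\<dots> = (\<Sum>p<n. \<Sum>q<m. A $$ (p, p) * B $$ (q, q))"
    unfolding sum_mult_product by (intro sum.cong refl) simp
  also have "\<dots> = mat_trace A * mat_trace B"
    using assms by (simp add: mat_trace_def sum_product)
  finally show ?thesis .
qed

text \<open>
  Here \<open>\<theta>\<close> is the character of some representation of the unitary group of degree \<open>n\<close> in degree \<open>N\<close>.
  Only traces enter the Hilbert--Schmidt distance, so the representations themselves can be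
  forgotten; what matters is that characters form a semiring.
\<close>

definition unitary_character :: "nat \<Rightarrow> nat \<Rightarrow> (complex mat \<Rightarrow> complex) \<Rightarrow> bool" where
  "unitary_character n N \<theta> \<longleftrightarrow>
     (\<exists>D\<in>hom (unitary_group n) (unitary_group N). \<forall>u\<in>carrier (unitary_group n). mat_trace (D u) = \<theta> u)"

lemma unitary_character_trace: "unitary_character n n mat_trace"
  unfolding unitary_character_def by (rule bexI[of _ "\<lambda>u. u"]) (auto intro: homI)

lemma unitary_character_const: "unitary_character n N (\<lambda>_. of_nat N)"
proof -
  have "(\<lambda>_. 1\<^sub>m N) \<in> hom (unitary_group n) (unitary_group N)"
    using group.is_monoid[OF group_unitary_group, of N, THEN monoid.one_closed] by (intro homI) simp_all
  then show ?thesis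
    unfolding unitary_character_def by (rule bexI[rotated]) (simp add: mat_trace_def)
qed

text \<open>
  The common part of the arguments for direct sums and for tensor products: any operation on matrices
  that respects products, adjoints and identities combines two representations into one.
\<close>

lemma unitary_character_binary:
  assumes 1: "unitary_character n N\<^sub>1 \<theta>\<^sub>1" and 2: "unitary_character n N\<^sub>2 \<theta>\<^sub>2"
    and carr: "\<And>A B. A \<in> carrier_mat N\<^sub>1 N\<^sub>1 \<Longrightarrow> B \<in> carrier_mat N\<^sub>2 N\<^sub>2 \<Longrightarrow> F A B \<in> carrier_mat N N"
    and adj: "\<And>A B. A \<in> carrier_mat N\<^sub>1 N\<^sub>1 \<Longrightarrow> B \<in> carrier_mat N\<^sub>2 N\<^sub>2 \<Longrightarrow>
      F (mat_adjoint A) (mat_adjoint B) = mat_adjoint (F A B)"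
    and mult: "\<And>A B C D. A \<in> carrier_mat N\<^sub>1 N\<^sub>1 \<Longrightarrow> B \<in> carrier_mat N\<^sub>2 N\<^sub>2 \<Longrightarrow>
      C \<in> carrier_mat N\<^sub>1 N\<^sub>1 \<Longrightarrow> D \<in> carrier_mat N\<^sub>2 N\<^sub>2 \<Longrightarrow> F (A * C) (B * D) = F A B * F C D"
    and one: "F (1\<^sub>m N\<^sub>1) (1\<^sub>m N\<^sub>2) = 1\<^sub>m N"
    and tr: "\<And>A B. A \<in> carrier_mat N\<^sub>1 N\<^sub>1 \<Longrightarrow> B \<in> carrier_mat N\<^sub>2 N\<^sub>2 \<Longrightarrow>
      mat_trace (F A B) = f (mat_trace A) (mat_trace B)"
  shows "unitary_character n N (\<lambda>u. f (\<theta>\<^sub>1 u) (\<theta>\<^sub>2 u))"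
proof -
  obtain D\<^sub>1 D\<^sub>2 where D: "D\<^sub>1 \<in> hom (unitary_group n) (unitary_group N\<^sub>1)" "D\<^sub>2 \<in> hom (unitary_group n) (unitary_group N\<^sub>2)"
    and \<theta>: "\<And>u. u \<in> carrier (unitary_group n) \<Longrightarrow> mat_trace (D\<^sub>1 u) = \<theta>\<^sub>1 u"
      "\<And>u. u \<in> carrier (unitary_group n) \<Longrightarrow> mat_trace (D\<^sub>2 u) = \<theta>\<^sub>2 u"
    using 1 2 unfolding unitary_character_def by blast
  have D': "D\<^sub>1 u \<in> carrier_mat N\<^sub>1 N\<^sub>1" "D\<^sub>2 u \<in> carrier_mat N\<^sub>2 N\<^sub>2" if "u \<in> carrier (unitary_group n)" for u
    using hom_in_carrier[OF D(1) that] hom_in_carrier[OF D(2) that] by (simp_all add: carrier_unitary_group)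
  have D_one: "E (1\<^sub>m n) = 1\<^sub>m p" if E: "E \<in> hom (unitary_group n) (unitary_group p)" for E p
    using hom_one[OF E group_unitary_group group_unitary_group] by simp
  have "(\<lambda>u. F (D\<^sub>1 u) (D\<^sub>2 u)) \<in> hom (unitary_group n) (unitary_group N)"
  proof (rule unitary_group_homI)
    fix u v assume uv: "u \<in> carrier (unitary_group n)" "v \<in> carrier (unitary_group n)"
    show "F (D\<^sub>1 (u * v)) (D\<^sub>2 (u * v)) = F (D\<^sub>1 u) (D\<^sub>2 u) * F (D\<^sub>1 v) (D\<^sub>2 v)"
      using mult[OF D'[OF uv(1)] D'[OF uv(2)]] hom_mult[OF D(1) uv] hom_mult[OF D(2) uv] by simp
  qed (use D' carr adj in \<open>simp_all add: hom_unitary_adjoint[OF D(1)] hom_unitary_adjoint[OF D(2)] D_one[OF D(1)] D_one[OF D(2)] one\<close>)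
  then show ?thesis
    unfolding unitary_character_def by (rule bexI[rotated]) (simp add: tr D' \<theta>)
qed

lemma unitary_character_add:
  assumes "unitary_character n N\<^sub>1 \<theta>\<^sub>1" "unitary_character n N\<^sub>2 \<theta>\<^sub>2"
  shows "unitary_character n (N\<^sub>1 + N\<^sub>2) (\<lambda>u. \<theta>\<^sub>1 u + \<theta>\<^sub>2 u)"
  by (rule unitary_character_binary[OF assms, where F = direct_sum])
    (simp_all add: direct_sum_adjoint direct_sum_mult direct_sum_one mat_trace_direct_sum)

lemma unitary_character_mult:
  assumes "unitary_character n N\<^sub>1 \<theta>\<^sub>1" "unitary_character n N\<^sub>2 \<theta>\<^sub>2"
  shows "unitary_character n (N\<^sub>1 * N\<^sub>2) (\<lambda>u. \<theta>\<^sub>1 u * \<theta>\<^sub>2 u)"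
  by (rule unitary_character_binary[OF assms, where F = kronecker])
    (simp_all add: kronecker_adjoint kronecker_mult kronecker_one mat_trace_kronecker)

lemma unitary_character_power:
  assumes "unitary_character n N \<theta>"
  shows "unitary_character n (N ^ m) (\<lambda>u. \<theta> u ^ m)"
proof (induction m)
  case 0
  then show ?case using unitary_character_const[of n 1] by simp
next
  case (Suc m)
  then show ?case using unitary_character_mult[OF assms] by simp
qed

text \<open>
  The effect on normalized traces of the direct sum, with weights \<open>k : 1\<close>, of the identity
  representation and the \<open>m\<close>-th tensor power of its sum with an equally large trivial one.
\<close>

definition separating_poly :: "nat \<Rightarrow> nat \<Rightarrow> complex \<Rightarrow> complex" where
  "separating_poly k m t = (of_nat k * t + ((1 + t) / 2) ^ m) / of_nat (Suc k)"

text \<open>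
  To realize the weights \<open>k : 1\<close>, the summands \<open>u\<close> of degree \<open>n\<close> and \<open>(1 \<oplus> u)\<^bsup>\<otimes>m\<^esup>\<close> of degree \<open>(2 n)\<^sup>m\<close>
  are first brought to a common degree by tensoring each with an identity matrix.
\<close>

lemma separating_hom_exists:
  assumes n: "0 < n"
  obtains N D where "0 < N" "D \<in> hom (unitary_group n) (unitary_group N)"
    "\<And>u. u \<in> carrier (unitary_group n) \<Longrightarrow>
      mat_trace (D u) / of_nat N = separating_poly k m (mat_trace u / of_nat n)"
proof -
  let ?N = "(k * (n + n) ^ m) * n + n * (n + n) ^ m"
  have "unitary_character n ?N (\<lambda>u. of_nat (k * (n + n) ^ m) * mat_trace u + of_nat n * (of_nat n + mat_trace u) ^ m)"
    by (intro unitary_character_add unitary_character_mult unitary_character_power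
        unitary_character_const unitary_character_trace)
  then obtain D where D: "D \<in> hom (unitary_group n) (unitary_group ?N)"
    "\<And>u. u \<in> carrier (unitary_group n) \<Longrightarrow>
      mat_trace (D u) = of_nat (k * (n + n) ^ m) * mat_trace u + of_nat n * (of_nat n + mat_trace u) ^ m"
    unfolding unitary_character_def by blast
  have poly: "(of_nat (k * (n + n) ^ m) * t + of_nat n * (of_nat n + t) ^ m) / of_nat ?N =
      separating_poly k m (t / of_nat n)" for t :: complex
  proof -
    define c where "c = (of_nat (n + n) :: complex)"
    define s where "s = t / of_nat n"
    have c: "c ^ m \<noteq> 0" "of_nat n \<noteq> (0 :: complex)" using n by (simp_all add: c_def flip: of_nat_add)
    have t: "t = of_nat n * s" "of_nat n + t = c * ((1 + s) / 2)"
      using c by (simp_all add: s_def c_def field_simps)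
    have "of_nat (k * (n + n) ^ m) * t + of_nat n * (of_nat n + t) ^ m =
        (of_nat n * c ^ m) * (of_nat k * s + ((1 + s) / 2) ^ m)"
      unfolding t(2) power_mult_distrib by (simp add: t(1) c_def algebra_simps del: of_nat_add)
    moreover have "of_nat ?N = (of_nat n * c ^ m) * (of_nat (Suc k) :: complex)"
      by (simp add: c_def algebra_simps)
    ultimately show ?thesis
      unfolding separating_poly_def s_def[symmetric] using c
      by (simp only: mult_divide_mult_cancel_left mult_eq_0_iff simp_thms)
  qed
  have "0 < ?N" using n by simp
  then show thesis
    by (rule that[OF _ D(1)]) (simp only: D(2) poly)
qed

section \<open>Separating the points of a hyperlinear group\<close>

lemma mat_trace_adjoint_mult_sum:
  assumes "u \<in> carrier_mat n n" "v \<in> carrier_mat n n"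
  shows "mat_trace (mat_adjoint u * v) = (\<Sum>p\<in>{..<n} \<times> {..<n}. cnj (u $$ p) * v $$ p)"
proof -
  have "mat_trace (mat_adjoint u * v) = (\<Sum>i<n. \<Sum>j<n. mat_adjoint u $$ (i, j) * v $$ (j, i))"
    using assms mat_adjoint_carrier[OF assms(1)]
    by (simp add: mat_trace_def scalar_prod_def lessThan_atLeast0)
  also have "\<dots> = (\<Sum>i<n. \<Sum>j<n. cnj (u $$ (j, i)) * v $$ (j, i))"
    using assms by (intro sum.cong refl) (simp add: mat_adjoint_index)
  also have "\<dots> = (\<Sum>j<n. \<Sum>i<n. cnj (u $$ (j, i)) * v $$ (j, i))"
    by (rule sum.swap)
  finally show ?thesis by (simp add: sum.cartesian_product)
qed

text \<open>
  Cauchy--Schwarz for the entries of \<open>u\<close> and \<open>v\<close>.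
\<close>

lemma unitary_trace_bound:
  assumes "u \<in> carrier (unitary_group n)" "v \<in> carrier (unitary_group n)"
  shows "cmod (mat_trace (mat_adjoint u * v) / of_nat n) \<le> 1"
proof -
  let ?S = "{..<n} \<times> {..<n}"
  have "mat_trace (mat_adjoint u * v) = (\<Sum>p\<in>?S. cnj (u $$ p) * v $$ p)"
    using assms by (intro mat_trace_adjoint_mult_sum) (auto simp: carrier_unitary_group)
  then have "cmod (mat_trace (mat_adjoint u * v)) \<le> (\<Sum>p\<in>?S. \<bar>cmod (u $$ p)\<bar> * \<bar>cmod (v $$ p)\<bar>)"
    using norm_sum[of "\<lambda>p. cnj (u $$ p) * v $$ p" ?S] by (simp add: norm_mult)
  also have "\<dots> \<le> real n"
    using L2_set_mult_ineq[of "\<lambda>p. cmod (u $$ p)" "\<lambda>p. cmod (v $$ p)" ?S] assms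
    by (simp add: L2_set_unitary)
  finally show ?thesis by (cases "n = 0") (simp_all add: norm_divide divide_le_eq_1)
qed

text \<open>
  Expanding the square: a unitary matrix of degree \<open>n\<close> has squared Hilbert--Schmidt norm \<open>n\<close>, so only
  the mixed term depends on \<open>u\<close> and \<open>v\<close>.
\<close>

lemma hilbert_schmidt_dist_trace:
  assumes n: "0 < n" and u: "u \<in> carrier (unitary_group n)" and v: "v \<in> carrier (unitary_group n)"
  shows "1 / 2 * hilbert_schmidt_dist n u v = sqrt ((1 - Re (mat_trace (mat_adjoint u * v) / of_nat n)) / 2)"
proof -
  let ?S = "{..<n} \<times> {..<n}"
  have sq: "(\<Sum>p\<in>?S. (cmod (w $$ p))\<^sup>2) = real n" if "w \<in> carrier (unitary_group n)" for w
  proof -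
    have "(\<Sum>p\<in>?S. (cmod (w $$ p))\<^sup>2) = (L2_set (\<lambda>p. cmod (w $$ p)) ?S)\<^sup>2"
      unfolding L2_set_def by (simp add: sum_nonneg)
    then show ?thesis using L2_set_unitary[OF that] by simp
  qed
  have pt: "(cmod (a - b))\<^sup>2 = (cmod a)\<^sup>2 + (cmod b)\<^sup>2 - 2 * Re (cnj a * b)" for a b
    unfolding cmod_power2 by (simp add: power2_eq_square algebra_simps)
  have "mat_trace (mat_adjoint u * v) = (\<Sum>p\<in>?S. cnj (u $$ p) * v $$ p)"
    using u v by (intro mat_trace_adjoint_mult_sum) (auto simp: carrier_unitary_group)
  then have "Re (mat_trace (mat_adjoint u * v)) = (\<Sum>p\<in>?S. Re (cnj (u $$ p) * v $$ p))"
    by simp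
  then have "(\<Sum>p\<in>?S. (cmod (u $$ p - v $$ p))\<^sup>2) = 2 * real n - 2 * Re (mat_trace (mat_adjoint u * v))"
    unfolding pt sum.distrib sum_subtractf sum_distrib_left[symmetric] by (simp only: sq[OF u] sq[OF v])
  then have "hilbert_schmidt_dist n u v = sqrt (2 * real n - 2 * Re (mat_trace (mat_adjoint u * v))) / sqrt (real n)"
    using hilbert_schmidt_dist_L2[OF u v] by (simp add: L2_set_def)
  also have "\<dots> = sqrt (4 * ((1 - Re (mat_trace (mat_adjoint u * v) / of_nat n)) / 2))"
    using n unfolding real_sqrt_divide[symmetric]
    by (intro arg_cong[where f = sqrt]) (simp add: field_simps)
  finally show ?thesis by (simp only: real_sqrt_mult) simp
qed

text \<open>
  A representation maps \<open>u\<^sup>* v\<close> to \<open>D(u)\<^sup>* D(v)\<close>, so its effect on traces determines its effect on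
  distances.
\<close>

lemma separating_hom_dist:
  assumes N: "0 < N" and D: "D \<in> hom (unitary_group n) (unitary_group N)"
    and tr: "\<And>u. u \<in> carrier (unitary_group n) \<Longrightarrow>
      mat_trace (D u) / of_nat N = separating_poly k m (mat_trace u / of_nat n)"
    and u: "u \<in> carrier (unitary_group n)" and v: "v \<in> carrier (unitary_group n)"
  shows "1 / 2 * hilbert_schmidt_dist N (D u) (D v) =
    sqrt ((1 - Re (separating_poly k m (mat_trace (mat_adjoint u * v) / of_nat n))) / 2)"
proof -
  have u': "mat_adjoint u \<in> carrier (unitary_group n)"
    using u by (simp add: carrier_unitary_group mat_adjoint_adjoint)
  have uv: "mat_adjoint u * v \<in> carrier (unitary_group n)"
    using group.is_monoid[OF group_unitary_group, of n, THEN monoid.m_closed, OF u' v] by simp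
  have "mat_adjoint (D u) * D v = D (mat_adjoint u * v)"
    using hom_mult[OF D u' v] hom_unitary_adjoint[OF D u] by simp
  then show ?thesis
    using hilbert_schmidt_dist_trace[OF N hom_in_carrier[OF D u] hom_in_carrier[OF D v]] tr[OF uv] by simp
qed

text \<open>
  This is where points get separated.  From \<open>\<bar>t\<bar> \<le> 1\<close> one gets \<open>\<bar>1 + t\<bar>\<^sup>2 \<le> 2 + 2 Re t = 4 - 4 r\<^sup>2\<close>, so the
  tensor power dies out unless \<open>r = 0\<close>; and \<open>r = 0\<close> forces \<open>t = 1\<close>, where it is constantly \<open>1\<close>.
\<close>

lemma separating_poly_tendsto:
  assumes t: "cmod t \<le> 1" "Re t = 1 - 2 * r\<^sup>2"
  shows "(\<lambda>m. sqrt ((1 - Re (separating_poly k m t)) / 2)) \<longlonglongrightarrow>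
    sqrt ((real k * r\<^sup>2 + (if r = 0 then 0 else 1 / 2)) / real (Suc k))"
proof -
  let ?l = "if r = 0 then 1 else 0 :: complex"
  have tt: "(Re t)\<^sup>2 + (Im t)\<^sup>2 \<le> 1"
    using t(1) by (metis cmod_power2 norm_ge_zero power_le_one)
  have pow: "(\<lambda>m. ((1 + t) / 2) ^ m) \<longlonglongrightarrow> ?l"
  proof (cases "r = 0")
    case True
    then have "t = 1" using t(2) tt by (auto simp: complex_eq_iff)
    then show ?thesis using True by simp
  next
    case False
    have "(cmod (1 + t))\<^sup>2 = 1 + 2 * Re t + ((Re t)\<^sup>2 + (Im t)\<^sup>2)"
      unfolding cmod_power2 by (simp add: power2_eq_square algebra_simps)
    also have "\<dots> < 4" using tt t(2) zero_less_power2[of r] False by linarith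
    finally have "cmod (1 + t) < 2" by (intro power2_less_imp_less[of _ 2]) simp_all
    then have "cmod ((1 + t) / 2) < 1" by (simp add: norm_divide)
    from LIMSEQ_power_zero[OF this] show ?thesis using False by simp
  qed
  have "(\<lambda>m. sqrt ((1 - Re (separating_poly k m t)) / 2)) \<longlonglongrightarrow>
      sqrt ((1 - Re ((of_nat k * t + ?l) / of_nat (Suc k))) / 2)"
    unfolding separating_poly_def by (intro tendsto_intros pow) (simp_all del: of_nat_Suc)
  also have "Re ((of_nat k * t + ?l) / of_nat (Suc k)) =
      (real k * (1 - 2 * r\<^sup>2) + (if r = 0 then 1 else 0)) / real (Suc k)"
    by (cases "r = 0") (simp_all add: Re_divide_of_nat t(2) del: of_nat_Suc)
  also have "(1 - \<dots>) / 2 = (real k * r\<^sup>2 + (if r = 0 then 0 else 1 / 2)) / real (Suc k)"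
    by (cases "r = 0") (simp_all add: field_simps)
  finally show ?thesis .
qed

text \<open>
  The filter of the iterated limit, first along \<open>F\<close> and then along \<open>G\<close>.  The product filter would not
  do, because the convergence along \<open>F\<close> is not uniform in the second variable.
\<close>

definition iterated_filter :: "'i filter \<Rightarrow> 'j filter \<Rightarrow> ('i \<times> 'j) filter" where
  "iterated_filter F G = Abs_filter (\<lambda>P. eventually (\<lambda>j. eventually (\<lambda>i. P (i, j)) F) G)"

lemma eventually_iterated_filter:
  "eventually P (iterated_filter F G) \<longleftrightarrow> eventually (\<lambda>j. eventually (\<lambda>i. P (i, j)) F) G"
  unfolding iterated_filter_def
proof (rule eventually_Abs_filter, rule is_filter.intro)
  fix P Q :: "'a \<times> 'b \<Rightarrow> bool"
  assume "\<forall>\<^sub>F j in G. \<forall>\<^sub>F i in F. P (i, j)" "\<forall>\<^sub>F j in G. \<forall>\<^sub>F i in F. Q (i, j)"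
  then show "\<forall>\<^sub>F j in G. \<forall>\<^sub>F i in F. P (i, j) \<and> Q (i, j)"
    by eventually_elim (rule eventually_conj)
next
  fix P Q :: "'a \<times> 'b \<Rightarrow> bool"
  assume PQ: "\<forall>x. P x \<longrightarrow> Q x" and "\<forall>\<^sub>F j in G. \<forall>\<^sub>F i in F. P (i, j)"
  then show "\<forall>\<^sub>F j in G. \<forall>\<^sub>F i in F. Q (i, j)"
    by (elim eventually_mono) (use PQ in blast)
qed simp

lemma tendsto_iterated_filter:
  fixes a :: "'i \<Rightarrow> 'j \<Rightarrow> 'b :: metric_space"
  assumes inner: "\<And>j. ((\<lambda>i. a i j) \<longlongrightarrow> b j) F" and outer: "(b \<longlongrightarrow> l) G"
  shows "((\<lambda>x. a (fst x) (snd x)) \<longlongrightarrow> l) (iterated_filter F G)"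
proof (rule tendstoI)
  fix \<epsilon> :: real assume "0 < \<epsilon>"
  then have \<epsilon>: "0 < \<epsilon> / 2" by simp
  have "\<forall>\<^sub>F j in G. \<forall>\<^sub>F i in F. dist (a i j) l < \<epsilon>"
    using tendstoD[OF outer \<epsilon>]
  proof (rule eventually_mono)
    fix j assume "dist (b j) l < \<epsilon> / 2"
    then have j: "dist l (b j) < \<epsilon> / 2" by (simp add: dist_commute)
    show "\<forall>\<^sub>F i in F. dist (a i j) l < \<epsilon>"
      using tendstoD[OF inner \<epsilon>, of j] by (rule eventually_mono) (rule dist_triangle_half_l[OF _ j])
  qed
  then show "\<forall>\<^sub>F x in iterated_filter F G. dist (a (fst x) (snd x)) l < \<epsilon>"
    by (simp add: eventually_iterated_filter)
qed

text \<open>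
  The distances control only the real part of the traces.  The imaginary part converges because it is
  bounded and \<open>\<Phi>\<close> is an ultrafilter; its limit is unknown, but the bound \<open>\<bar>t\<bar> \<le> 1\<close> makes up for that.
\<close>

lemma ultrafilter_unitary_trace_limit:
  assumes U: "ultrafilter_on I \<Phi>" and n: "\<And>i. i \<in> I \<Longrightarrow> 0 < n i"
    and u: "\<And>i. i \<in> I \<Longrightarrow> u i \<in> carrier (unitary_group (n i))"
    and v: "\<And>i. i \<in> I \<Longrightarrow> v i \<in> carrier (unitary_group (n i))"
    and lim: "((\<lambda>i. 1 / 2 * hilbert_schmidt_dist (n i) (u i) (v i)) \<longlongrightarrow> r) \<Phi>"
  obtains t where "((\<lambda>i. mat_trace (mat_adjoint (u i) * v i) / of_nat (n i)) \<longlongrightarrow> t) \<Phi>"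
    "cmod t \<le> 1" "Re t = 1 - 2 * r\<^sup>2"
proof -
  define T where "T = (\<lambda>i. mat_trace (mat_adjoint (u i) * v i) / of_nat (n i))"
  have I: "eventually (\<lambda>i. i \<in> I) \<Phi>" and proper: "\<Phi> \<noteq> bot"
    using U by (auto simp: ultrafilter_on_def)
  have T: "cmod (T i) \<le> 1" if "i \<in> I" for i
    unfolding T_def by (rule unitary_trace_bound[OF u[OF that] v[OF that]])
  have Re: "1 - 2 * (1 / 2 * hilbert_schmidt_dist (n i) (u i) (v i))\<^sup>2 = Re (T i)" if "i \<in> I" for i
  proof -
    have "Re (T i) \<le> 1" using T[OF that] complex_Re_le_cmod[of "T i"] by linarith
    moreover have "1 / 2 * hilbert_schmidt_dist (n i) (u i) (v i) = sqrt ((1 - Re (T i)) / 2)"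
      unfolding T_def by (rule hilbert_schmidt_dist_trace[OF n[OF that] u[OF that] v[OF that]])
    ultimately show ?thesis by (simp only:) (simp add: field_simps)
  qed
  have "((\<lambda>i. 1 - 2 * (1 / 2 * hilbert_schmidt_dist (n i) (u i) (v i))\<^sup>2) \<longlongrightarrow> 1 - 2 * r\<^sup>2) \<Phi>"
    by (intro tendsto_intros lim)
  then have ReT: "((\<lambda>i. Re (T i)) \<longlongrightarrow> 1 - 2 * r\<^sup>2) \<Phi>"
    by (rule Lim_transform_eventually) (use I Re in \<open>auto elim: eventually_mono\<close>)
  have "Im (T i) \<in> {-1..1}" if "i \<in> I" for i
    using T[OF that] abs_Im_le_cmod[of "T i"] by auto
  then obtain y where ImT: "((\<lambda>i. Im (T i)) \<longlongrightarrow> y) \<Phi>"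
    using ultrafilter_on_limit[OF U, of "\<lambda>i. Im (T i)" "-1" 1] by blast
  have T_lim: "(T \<longlongrightarrow> Complex (1 - 2 * r\<^sup>2) y) \<Phi>"
    using tendsto_Complex[OF ReT ImT] by simp
  have "cmod (Complex (1 - 2 * r\<^sup>2) y) \<le> 1"
    by (rule tendsto_upperbound[OF tendsto_norm[OF T_lim] _ proper]) (use I T in \<open>auto elim: eventually_mono\<close>)
  then show thesis using that T_lim unfolding T_def by simp
qed

text \<open>
  The representation \<open>D i m\<close> of the \<open>i\<close>-th unitary group is applied to the approximate representations
  \<open>\<phi> i\<close> of \<open>(G, d)\<close>, and the new family is indexed by the pairs \<open>(i, m)\<close>.
\<close>

theorem hyperlinear_separated_dist:
  fixes G :: "('a, 'm) monoid_scheme"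
  assumes "hyperlinear G d"
  shows "hyperlinear G (separated_dist d k)"
proof -
  obtain I :: "'a index set" and \<Phi> n f where cG: "complete_metric_group G d"
    and U: "ultrafilter_on I \<Phi>" and n: "\<And>i. i \<in> I \<Longrightarrow> 0 < n i"
    and f: "f \<in> hom G (ultraproduct I \<Phi> (\<lambda>i. unitary_group (n i)) (\<lambda>i u v. 1 / 2 * hilbert_schmidt_dist (n i) u v))"
    and f_iso: "isometric_on G d (ultra_dist I \<Phi> (\<lambda>i. unitary_group (n i)) (\<lambda>i u v. 1 / 2 * hilbert_schmidt_dist (n i) u v)) f"
    using assms unfolding hyperlinear_def Let_def by blast
  interpret G: bi_invariant_metric_group G d using cG by (simp add: complete_metric_group_def)
  define H where "H = (\<lambda>i. unitary_group (n i))"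
  define h where "h = (\<lambda>i u v. 1 / 2 * hilbert_schmidt_dist (n i) u v)"
  note f = f[folded H_def h_def] and f_iso = f_iso[folded H_def h_def]
  interpret F: metric_group_family I \<Phi> H h
    unfolding H_def h_def by (rule metric_group_family.intro[OF U bi_invariant_unitary_group[OF n]])
  obtain \<phi> where \<phi>: "\<And>i x. i \<in> I \<Longrightarrow> x \<in> carrier G \<Longrightarrow> \<phi> i x \<in> carrier (H i)"
    and \<phi>_mult: "\<And>x y. x \<in> carrier G \<Longrightarrow> y \<in> carrier G \<Longrightarrow>
       ((\<lambda>i. h i (\<phi> i (x \<otimes>\<^bsub>G\<^esub> y)) (\<phi> i x \<otimes>\<^bsub>H i\<^esub> \<phi> i y)) \<longlongrightarrow> 0) \<Phi>"
    and \<phi>_ultra: "\<And>x y. x \<in> carrier G \<Longrightarrow> y \<in> carrier G \<Longrightarrow>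
       ((\<lambda>i. h i (\<phi> i x) (\<phi> i y)) \<longlongrightarrow> ultra_dist I \<Phi> H h (f x) (f y)) \<Phi>"
    using F.hom_ultraproduct_limits[OF f G.is_group] by blast
  have \<phi>_dist: "((\<lambda>i. h i (\<phi> i x) (\<phi> i y)) \<longlongrightarrow> d x y) \<Phi>" if "x \<in> carrier G" "y \<in> carrier G" for x y
    using \<phi>_ultra[OF that] f_iso that by (simp add: isometric_on_def)
  have "\<exists>N D. i \<in> I \<longrightarrow> 0 < N \<and> D \<in> hom (H i) (unitary_group N) \<and>
      (\<forall>u\<in>carrier (H i). mat_trace (D u) / of_nat N = separating_poly k m (mat_trace u / of_nat (n i)))" for i m
    using separating_hom_exists[OF n, of i k m] unfolding H_def by metis
  then obtain N D where N: "\<And>i m. i \<in> I \<Longrightarrow> 0 < N i m"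
    and D: "\<And>i m. i \<in> I \<Longrightarrow> D i m \<in> hom (H i) (unitary_group (N i m))"
    and tr: "\<And>i m u. i \<in> I \<Longrightarrow> u \<in> carrier (H i) \<Longrightarrow>
      mat_trace (D i m u) / of_nat (N i m) = separating_poly k m (mat_trace u / of_nat (n i))"
    by metis
  define e where "e = (\<lambda>i m u v. 1 / 2 * hilbert_schmidt_dist (N i m) u v)"
  \<comment> \<open>Serves twice: for \<open>u = \<phi>\<^sub>i(x)\<close>, \<open>v = \<phi>\<^sub>i(y)\<close> with \<open>r = d x y\<close>, and
    for \<open>u = \<phi>\<^sub>i(x y)\<close>, \<open>v = \<phi>\<^sub>i(x) \<phi>\<^sub>i(y)\<close> with \<open>r = 0\<close>.\<close>
  have lim: "((\<lambda>j. e (fst j) (snd j) (D (fst j) (snd j) (u (fst j))) (D (fst j) (snd j) (v (fst j)))) \<longlongrightarrow>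
      sqrt ((real k * r\<^sup>2 + (if r = 0 then 0 else 1 / 2)) / real (Suc k))) (iterated_filter \<Phi> sequentially)"
    if u: "\<And>i. i \<in> I \<Longrightarrow> u i \<in> carrier (H i)" and v: "\<And>i. i \<in> I \<Longrightarrow> v i \<in> carrier (H i)"
      and r: "((\<lambda>i. h i (u i) (v i)) \<longlongrightarrow> r) \<Phi>" for u v r
  proof -
    obtain t where t: "((\<lambda>i. mat_trace (mat_adjoint (u i) * v i) / of_nat (n i)) \<longlongrightarrow> t) \<Phi>"
      "cmod t \<le> 1" "Re t = 1 - 2 * r\<^sup>2"
      by (rule ultrafilter_unitary_trace_limit[OF U n u[unfolded H_def] v[unfolded H_def] r[unfolded h_def]])
    have inner: "((\<lambda>i. e i m (D i m (u i)) (D i m (v i))) \<longlongrightarrow> sqrt ((1 - Re (separating_poly k m t)) / 2)) \<Phi>" for m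
    proof -
      have "((\<lambda>i. sqrt ((1 - Re (separating_poly k m (mat_trace (mat_adjoint (u i) * v i) / of_nat (n i)))) / 2)) \<longlongrightarrow>
          sqrt ((1 - Re (separating_poly k m t)) / 2)) \<Phi>"
        unfolding separating_poly_def by (intro tendsto_intros t(1)) (simp_all del: of_nat_Suc)
      then show ?thesis
        unfolding e_def
        by (rule F.tendsto_cong_I[THEN iffD2, rotated]) (rule separating_hom_dist[OF N D[unfolded H_def] tr[unfolded H_def] u[unfolded H_def] v[unfolded H_def]])
    qed
    show ?thesis
      by (rule tendsto_iterated_filter[where a = "\<lambda>i m. e i m (D i m (u i)) (D i m (v i))", OF inner separating_poly_tendsto[OF t(2,3)]])
  qed
  have "iterated_filter \<Phi> sequentially \<noteq> bot"
    using F.proper by (simp add: trivial_limit_def eventually_iterated_filter)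
  then obtain \<Psi> where \<Psi>: "\<Psi> \<le> iterated_filter \<Phi> sequentially" "ultrafilter_on UNIV \<Psi>"
    using ultrafilter_below by blast
  have "eventually (\<lambda>j. j \<in> I \<times> UNIV) (iterated_filter \<Phi> sequentially)"
    using F.ev_I by (simp add: eventually_iterated_filter)
  then have \<Psi>_ultra: "ultrafilter_on (I \<times> UNIV) \<Psi>"
    using \<Psi> by (auto simp: ultrafilter_on_def dest: filter_leD)
  interpret S: metric_group_family "I \<times> UNIV" \<Psi> "\<lambda>j. unitary_group (N (fst j) (snd j))" "\<lambda>j. e (fst j) (snd j)"
    unfolding e_def by (rule metric_group_family.intro[OF \<Psi>_ultra bi_invariant_unitary_group]) (auto intro: N)
  define \<psi> where "\<psi> = (\<lambda>j x. D (fst j) (snd j) (\<phi> (fst j) x))"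
  obtain f' where f': "f' \<in> hom G (ultraproduct (I \<times> UNIV) \<Psi> (\<lambda>j. unitary_group (N (fst j) (snd j))) (\<lambda>j. e (fst j) (snd j)))"
    "\<And>x y. x \<in> carrier G \<Longrightarrow> y \<in> carrier G \<Longrightarrow>
      ultra_dist (I \<times> UNIV) \<Psi> (\<lambda>j. unitary_group (N (fst j) (snd j))) (\<lambda>j. e (fst j) (snd j)) (f' x) (f' y)
        = separated_dist d k x y"
  proof (rule S.limits_hom_ultraproduct[OF G.is_group, where \<phi> = \<psi> and D = "separated_dist d k"])
    show "\<psi> j x \<in> carrier (unitary_group (N (fst j) (snd j)))" if "j \<in> I \<times> UNIV" "x \<in> carrier G" for j x
      using that hom_in_carrier[OF D \<phi>] by (auto simp: \<psi>_def)
    fix x y assume xy: "x \<in> carrier G" "y \<in> carrier G"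
    have "separated_dist d k x y = sqrt ((real k * (d x y)\<^sup>2 + (if d x y = 0 then 0 else 1 / 2)) / real (Suc k))"
      using xy by (simp add: separated_dist_def)
    then show "((\<lambda>j. e (fst j) (snd j) (\<psi> j x) (\<psi> j y)) \<longlongrightarrow> separated_dist d k x y) \<Psi>"
      using tendsto_mono[OF \<Psi>(1) lim[OF \<phi>[OF _ xy(1)] \<phi>[OF _ xy(2)] \<phi>_dist[OF xy]]]
      by (simp only: \<psi>_def)
    have xy': "x \<otimes>\<^bsub>G\<^esub> y \<in> carrier G" using xy by simp
    have m: "\<phi> i x \<otimes>\<^bsub>H i\<^esub> \<phi> i y \<in> carrier (H i)" if "i \<in> I" for i
      by (intro monoid.m_closed group.is_monoid F.grp \<phi> that xy)
    have "((\<lambda>j. e (fst j) (snd j) (\<psi> j (x \<otimes>\<^bsub>G\<^esub> y)) (D (fst j) (snd j) (\<phi> (fst j) x \<otimes>\<^bsub>H (fst j)\<^esub> \<phi> (fst j) y))) \<longlongrightarrow> 0) \<Psi>"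
      using tendsto_mono[OF \<Psi>(1) lim[OF \<phi>[OF _ xy'] m \<phi>_mult[OF xy]]]
      by (simp add: \<psi>_def)
    then show "((\<lambda>j. e (fst j) (snd j) (\<psi> j (x \<otimes>\<^bsub>G\<^esub> y))
        (\<psi> j x \<otimes>\<^bsub>unitary_group (N (fst j) (snd j))\<^esub> \<psi> j y)) \<longlongrightarrow> 0) \<Psi>"
      by (rule S.tendsto_cong_I[THEN iffD2, rotated])
        (use hom_mult[OF D \<phi> \<phi>] xy in \<open>auto simp: \<psi>_def\<close>)
  qed (rule that)
  show ?thesis
    by (rule hyperlinear_if_embeds[OF separated_dist_discrete_complete(2)[OF G.bi_invariant_metric_group_axioms]
          \<Psi>_ultra, where n = "\<lambda>j. N (fst j) (snd j)" and f = f'])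
      (use N f' in \<open>auto simp: isometric_on_def e_def\<close>)
qed

section \<open>The approximation theorem\<close>

text \<open>
  The groups of the ultraproduct are plain monoid records, whereas \<open>G\<close> may carry further fields; the
  next lemmas discard them.
\<close>

lemma bi_invariant_truncate:
  assumes "bi_invariant_metric_group G d"
  shows "bi_invariant_metric_group (monoid.truncate G) d"
proof -
  interpret bi_invariant_metric_group G d by fact
  have "group (monoid.truncate G)"
    by (rule groupI) (auto simp: monoid.defs m_assoc intro: l_inv_ex)
  then show ?thesis
    using Metric_space_axioms
    unfolding bi_invariant_metric_group_def bi_invariant_metric_group_axioms_def
    by (simp add: monoid.defs left_invariant right_invariant dist_le_1)
qed

lemma complete_truncate: "complete_metric_group G d \<Longrightarrow> complete_metric_group (monoid.truncate G) d"
  using bi_invariant_truncate[of G d] by (simp add: complete_metric_group_def monoid.defs)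

lemma hom_truncate:
  "hom (monoid.truncate G) K = hom G K" "mon (monoid.truncate G) K = mon G K" "iso (monoid.truncate G) K = iso G K"
  by (simp_all add: hom_def mon_def iso_def monoid.defs)

lemma isometric_on_truncate: "isometric_on (monoid.truncate G) d e f \<longleftrightarrow> isometric_on G d e f"
  by (simp add: isometric_on_def monoid.defs)

theorem theorem2p4:
  fixes G :: "('a, 'm) monoid_scheme" and d :: "'a \<Rightarrow> 'a \<Rightarrow> real"
  assumes "complete_metric_group G d"
  shows "(\<exists>(I :: 'a index set) \<Phi> (H :: 'a index \<Rightarrow> 'a monoid) e.
            ultrafilter_on I \<Phi> \<and>
            (\<forall>i\<in>I. discrete_metric_group (H i) (e i)) \<and>
            iso_to_closed_subgroup G d (ultraproduct I \<Phi> H e) (ultra_dist I \<Phi> H e) \<and>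
            (weakly_sofic G \<longrightarrow> (\<forall>i\<in>I. weakly_sofic (H i))))
       \<and> (hyperlinear G d \<longrightarrow>
          (\<exists>(I :: 'a index set) \<Phi> (H :: 'a index \<Rightarrow> 'a monoid) e.
            ultrafilter_on I \<Phi> \<and>
            (\<forall>i\<in>I. discrete_metric_group (H i) (e i) \<and> hyperlinear (H i) (e i)) \<and>
            iso_to_closed_subgroup G d (ultraproduct I \<Phi> H e) (ultra_dist I \<Phi> H e)))"
proof -
  define M where "M = monoid.truncate G"
  have cM: "complete_metric_group M d"
    unfolding M_def by (rule complete_truncate[OF assms])
  interpret M: bi_invariant_metric_group M d using cM by (simp add: complete_metric_group_def)
  define e :: "'a index \<Rightarrow> 'a \<Rightarrow> 'a \<Rightarrow> real" where "e = (\<lambda>j. separated_dist d (snd j))"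
  \<comment> \<open>Only the numerical part of an index matters; the sets \<open>{}\<close> are fillers.\<close>
  have "filtermap (\<lambda>k. ({}, k)) sequentially \<noteq> (bot :: 'a index filter)"
    by (simp add: filtermap_bot_iff)
  then obtain \<Phi> :: "'a index filter" where
    \<Phi>: "\<Phi> \<le> filtermap (\<lambda>k. ({}, k)) sequentially" "ultrafilter_on UNIV \<Phi>"
    using ultrafilter_below by blast
  have "((\<lambda>j. e j x y) \<longlongrightarrow> d x y) \<Phi>" if "x \<in> carrier M" "y \<in> carrier M" for x y
    using that unfolding e_def
    by (intro tendsto_mono[OF \<Phi>(1)]) (simp add: filterlim_filtermap separated_dist_tendsto)
  then have "iso_to_closed_subgroup M d (ultraproduct UNIV \<Phi> (\<lambda>_. M) e) (ultra_dist UNIV \<Phi> (\<lambda>_. M) e)"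
    by (intro pointwise_limit_closed_subgroup[OF cM \<Phi>(2)])
      (simp_all add: e_def bi_invariant_separated_dist M.bi_invariant_metric_group_axioms)
  then have closed: "iso_to_closed_subgroup G d (ultraproduct UNIV \<Phi> (\<lambda>_. M) e) (ultra_dist UNIV \<Phi> (\<lambda>_. M) e)"
    unfolding iso_to_closed_subgroup_def M_def hom_truncate isometric_on_truncate .
  have discrete: "discrete_metric_group M (e j)" for j
    unfolding e_def by (rule separated_dist_discrete_complete(1)[OF M.bi_invariant_metric_group_axioms])
  have "weakly_sofic M" if "weakly_sofic G"
    using that M.is_group unfolding weakly_sofic_def M_def hom_truncate by blast
  moreover have "hyperlinear M (e j)" if "hyperlinear G d" for j
  proof -
    have "hyperlinear M d"
      using that cM unfolding hyperlinear_def M_def hom_truncate isometric_on_truncate by blast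
    then show ?thesis unfolding e_def by (rule hyperlinear_separated_dist)
  qed
  ultimately show ?thesis
    using \<Phi>(2) discrete closed
    by (intro conjI impI exI[of _ UNIV] exI[of _ \<Phi>] exI[of _ "\<lambda>_. M"] exI[of _ e]) auto
qed

end
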